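(* Let $S$ be a finite or countably infinite set, let $B=(B(x,y):x,y\in S)$ be an irreducible sub-stochastic matrix, and fix $z\in S$. Let $X$, $T$, $\tau$, $P_x$, $E_x$ be as in the context. Suppose that $\theta\ge0$ satisfies $$E_z e^{\theta\tau}I(T>\tau)=1\qquad\text{and}\qquad E_z\,\tau e^{\theta\tau}I(T>\tau)<\infty .$$ Set $\lambda_*=e^{-\theta}$ and, for $x,y\in S$, $$u_*(x)=E_x e^{\theta\tau}I(T>\tau),\qquad \eta_*(y)=E_z\sum_{j=0}^{\tau-1}e^{\theta j}I(X_j=y,\;T>j).$$ Then: (i) If $u$ is a positive column vector satisfying $Bu=\lambda_*u$, then $u$ is a positive multiple of $u_*$. (ii) If $\eta$ is a positive row vector satisfying $\eta B=\lambda_*\eta$, then $\eta$ is a positive multiple of $\eta_*$. (iii) $\sum_{w\in S}\eta_*(w)u_*(w)<\infty$. (iv) If $p$ is the period of $B$, then for all $x,y\in S$, $$\frac1p\sum_{j=0}^{p-1}\lambda_*^{-pn-j}B^{pn+j}(x,y)\;\longrightarrow\;\frac{u_*(x)\eta_*(y)}{\sum_{w\in S}u_*(w)\eta_*(w)}\qquad\text{as }n\to\infty .$$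
   Context: A matrix $B=(B(x,y):x,y\in S)$ is sub-stochastic if $B(x,y)\ge 0$ and $\sum_{y\in S}B(x,y)\le 1$ for all $x\in S$. It is irreducible if for all $x,y\in S$ there is $n=n(x,y)\ge 1$ with $B^n(x,y)>0$. The period of an irreducible $B$ is $\gcd\{k\ge1:B^k(x,x)>0\}$, which does not depend on $x\in S$. Vectors are real (finite) valued, and positive means strictly positive in every entry. Column vectors are acted on by $(Bu)(x)=\sum_{y\in S}B(x,y)u(y)$ and row vectors by $(\eta B)(y)=\sum_{x\in S}\eta(x)B(x,y)$. Let $\Delta\notin S$, $S_\Delta=S\cup\{\Delta\}$, and let $P$ be the stochastic matrix on $S_\Delta$ given by $P(x,y)=B(x,y)$ for $x,y\in S$; $P(x,\Delta)=1-\sum_{y\in S}B(x,y)$ for $x\in S$; $P(\Delta,\Delta)=1$; $P(\Delta,y)=0$ for $y\in S$. Let $X=(X_n:n\ge 0)$ be the Markov chain on $S_\Delta$ with transition matrix $P$; $P_x$ and $E_x$ denote probability and expectation given $X_0=x$. Let $T=\inf\{n\ge 0:X_n=\Delta\}$ and, for the fixed $z\in S$, $\tau=\inf\{n\ge 1:X_n=z\}$ (with $\inf\emptyset=\infty$). $I(\cdot)$ is the indicator, and $I(T>\tau)$ is interpreted as $\sum_{k=1}^\infty I(\tau=k,\,T>k)$, so that $\tau$ is finite on $\{T>\tau\}$ (even when $T=\infty$); thus $E_xe^{\theta\tau}I(T>\tau)=\sum_{k\ge1}e^{\theta k}P_x(\tau=k,T>k)$. *)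

theory Defs
  imports "HOL-Probability.Probability"
begin

text \<open>
  The index set \<open>S\<close> is a type of class \<^class>\<open>countable\<close>, and \<open>S\<close> with the extra point is
  \<open>'s option\<close>, the cemetery state being \<^const>\<open>None\<close>.
\<close>

text \<open>Summability is required explicitly because \<^const>\<open>infsum\<close> is \<open>0\<close> on non-summable families.\<close>

definition substochastic :: "('s \<Rightarrow> 's \<Rightarrow> real) \<Rightarrow> bool" where
  "substochastic B \<longleftrightarrow> (\<forall>x y. 0 \<le> B x y) \<and>
     (\<forall>x. (\<lambda>y. B x y) summable_on UNIV \<and> (\<Sum>\<^sub>\<infinity>y. B x y) \<le> 1)"

primrec mat_pow :: "('s \<Rightarrow> 's \<Rightarrow> real) \<Rightarrow> nat \<Rightarrow> 's \<Rightarrow> 's \<Rightarrow> real" where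
  "mat_pow B 0 x y = (if x = y then 1 else 0)"
| "mat_pow B (Suc n) x y = (\<Sum>\<^sub>\<infinity>w. B x w * mat_pow B n w y)"

definition irreducible_mat :: "('s \<Rightarrow> 's \<Rightarrow> real) \<Rightarrow> bool" where
  "irreducible_mat B \<longleftrightarrow> (\<forall>x y. \<exists>n\<ge>1. mat_pow B n x y > 0)"

definition period_at :: "('s \<Rightarrow> 's \<Rightarrow> real) \<Rightarrow> 's \<Rightarrow> nat" where
  "period_at B x = Gcd {k. 1 \<le> k \<and> mat_pow B k x x > 0}"

text \<open>
  \<open>B u = l u\<close> and \<open>\<eta> B = l \<eta>\<close>, including convergence of the defining sums.
\<close>

definition right_eigenvector :: "('s \<Rightarrow> 's \<Rightarrow> real) \<Rightarrow> real \<Rightarrow> ('s \<Rightarrow> real) \<Rightarrow> bool" where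
  "right_eigenvector B l u \<longleftrightarrow> (\<forall>x. ((\<lambda>y. B x y * u y) has_sum (l * u x)) UNIV)"

definition left_eigenvector :: "('s \<Rightarrow> 's \<Rightarrow> real) \<Rightarrow> real \<Rightarrow> ('s \<Rightarrow> real) \<Rightarrow> bool" where
  "left_eigenvector B l \<eta> \<longleftrightarrow> (\<forall>y. ((\<lambda>x. \<eta> x * B x y) has_sum (l * \<eta> y)) UNIV)"

fun cemetery_ext :: "('s \<Rightarrow> 's \<Rightarrow> real) \<Rightarrow> 's option \<Rightarrow> 's option \<Rightarrow> real" where
  "cemetery_ext B (Some x) (Some y) = B x y"
| "cemetery_ext B (Some x) None = 1 - (\<Sum>\<^sub>\<infinity>y. B x y)"
| "cemetery_ext B None None = 1"
| "cemetery_ext B None (Some y) = 0"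

text \<open>
  The Markov property is written multiplicatively, so that conditioning on null events
  imposes nothing.
\<close>

definition markov_chain ::
    "'w measure \<Rightarrow> (nat \<Rightarrow> 'w \<Rightarrow> 't) \<Rightarrow> ('t \<Rightarrow> 't \<Rightarrow> real) \<Rightarrow> 't \<Rightarrow> bool" where
  "markov_chain M X K x \<longleftrightarrow>
     prob_space M \<and>
     (\<forall>n. X n \<in> measurable M (count_space UNIV)) \<and>
     (AE \<omega> in M. X 0 \<omega> = x) \<and>
     (\<forall>n s y. \<P>(\<omega> in M. (\<forall>i\<le>n. X i \<omega> = s i) \<and> X (Suc n) \<omega> = y)
            = \<P>(\<omega> in M. \<forall>i\<le>n. X i \<omega> = s i) * K (s n) y)"

text \<open>The infimum of the empty set of extended naturals is \<open>\<infinity>\<close>.\<close>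

definition absorption_time :: "(nat \<Rightarrow> 'w \<Rightarrow> 's option) \<Rightarrow> 'w \<Rightarrow> enat" where
  "absorption_time X \<omega> = (INF n\<in>{n. X n \<omega> = None}. enat n)"

definition return_time :: "(nat \<Rightarrow> 'w \<Rightarrow> 's option) \<Rightarrow> 's \<Rightarrow> 'w \<Rightarrow> enat" where
  "return_time X z \<omega> = (INF n\<in>{n. 1 \<le> n \<and> X n \<omega> = Some z}. enat n)"

text \<open>
  In the next two definitions the strict inequality forces \<open>\<tau> = return_time X z \<omega>\<close> to be finite,
  so they are \<open>e\<^sup>\<theta>\<^sup>\<tau> I(T > \<tau>)\<close> and \<open>\<tau> e\<^sup>\<theta>\<^sup>\<tau> I(T > \<tau>)\<close> with
  \<open>I(T > \<tau>) = (\<Sum>k\<ge>1. I(\<tau> = k, T > k))\<close>, also when \<open>T = \<infinity>\<close>.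
\<close>

definition exp_return :: "real \<Rightarrow> (nat \<Rightarrow> 'w \<Rightarrow> 's option) \<Rightarrow> 's \<Rightarrow> 'w \<Rightarrow> ennreal" where
  "exp_return \<theta> X z \<omega> =
     (if return_time X z \<omega> < absorption_time X \<omega>
      then ennreal (exp (\<theta> * real (the_enat (return_time X z \<omega>)))) else 0)"

definition time_exp_return :: "real \<Rightarrow> (nat \<Rightarrow> 'w \<Rightarrow> 's option) \<Rightarrow> 's \<Rightarrow> 'w \<Rightarrow> ennreal" where
  "time_exp_return \<theta> X z \<omega> =
     (if return_time X z \<omega> < absorption_time X \<omega>
      then ennreal (real (the_enat (return_time X z \<omega>))
                    * exp (\<theta> * real (the_enat (return_time X z \<omega>)))) else 0)"

text \<open>
  The expectations below are \<^typ>\<open>ennreal\<close>-valued, hence defined without any integrability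
  assumption; \<open>Q x\<close> is the law under which the chain starts at \<open>x\<close>.  In \<open>eta_star\<close> the sum over
  \<open>j < \<tau>\<close> is an infinite series when \<open>\<tau> = \<infinity>\<close>.
\<close>

definition u_star ::
    "('s option \<Rightarrow> 'w measure) \<Rightarrow> (nat \<Rightarrow> 'w \<Rightarrow> 's option) \<Rightarrow> real \<Rightarrow> 's \<Rightarrow> 's \<Rightarrow> ennreal" where
  "u_star Q X \<theta> z x = (\<integral>\<^sup>+\<omega>. exp_return \<theta> X z \<omega> \<partial>Q (Some x))"

definition eta_star ::
    "('s option \<Rightarrow> 'w measure) \<Rightarrow> (nat \<Rightarrow> 'w \<Rightarrow> 's option) \<Rightarrow> real \<Rightarrow> 's \<Rightarrow> 's \<Rightarrow> ennreal" where
  "eta_star Q X \<theta> z y =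
     (\<integral>\<^sup>+\<omega>. (\<Sum>j. if enat j < return_time X z \<omega> \<and> X j \<omega> = Some y \<and> enat j < absorption_time X \<omega>
                 then ennreal (exp (\<theta> * real j)) else 0) \<partial>Q (Some z))"

end

theory Submission
  imports Defs
begin

text \<open>
  Rescale to \<open>A = e\<^sup>\<theta> B\<close>, acting on \<^typ>\<open>ennreal\<close>-valued functions, so that every sum converges
  and sums may be interchanged freely; let \<open>F n x\<close> be the \<open>A\<close>-weight of the paths from \<open>x\<close> that
  hit \<open>z\<close> for the first time at time \<open>n + 1\<close>, so that \<open>u\<^sub>* = (\<Sum>n. F n)\<close>. Decomposing \<open>A\<^sup>n\<close> at
  the first entrance into \<open>z\<close> shows that a positive solution of \<open>A u = u\<close> dominates
  \<open>u(z) u\<^sub>*\<close>; as both are fixed by \<open>A\<close> and agree at \<open>z\<close>, irreducibility makes them equal. The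
  row vector \<open>\<eta>\<^sub>*\<close> is the vector \<open>u\<^sub>*\<close> of the transposed matrix, which yields the statement about
  left eigenvectors and the last-exit decomposition from the same lemmas. Pairing the two vectors
  counts each return of length \<open>k\<close> exactly \<open>k\<close> times, so \<open>\<eta>\<^sub>* u\<^sub>*\<close> sums to the mean weighted return
  time \<open>m\<close>. By the renewal theorem the averages of \<open>A\<^sup>n(z,z)\<close> over a period tend to \<open>1 / m\<close>, and
  the first-entrance and last-exit decompositions transfer this to \<open>A\<^sup>n(x,y)\<close>.
\<close>

section \<open>First-entrance decompositions for nonnegative matrices\<close>

definition act :: "('s \<Rightarrow> 's \<Rightarrow> ennreal) \<Rightarrow> ('s \<Rightarrow> ennreal) \<Rightarrow> 's \<Rightarrow> ennreal" where
  "act A h x = (\<integral>\<^sup>+ w. A x w * h w \<partial>count_space UNIV)"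

text \<open>Only the state entered by a step is forbidden to be \<open>z\<close>; the starting state
  may be \<open>z\<close>. Iterates evaluated at \<open>z\<close> therefore describe excursions from
  \<open>z\<close>.\<close>

definition taboo_act :: "('s \<Rightarrow> 's \<Rightarrow> ennreal) \<Rightarrow> 's \<Rightarrow> ('s \<Rightarrow> ennreal) \<Rightarrow> 's \<Rightarrow> ennreal" where
  "taboo_act A z h = act A (\<lambda>w. if w = z then 0 else h w)"

text \<open>Index shift: \<open>first_hit A z n x\<close> is the weight of the paths that hit \<open>z\<close> first at time \<open>n + 1\<close>.\<close>

definition first_hit :: "('s \<Rightarrow> 's \<Rightarrow> ennreal) \<Rightarrow> 's \<Rightarrow> nat \<Rightarrow> 's \<Rightarrow> ennreal" where
  "first_hit A z n = (taboo_act A z ^^ n) (\<lambda>x. A x z)"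

definition hit_total :: "('s \<Rightarrow> 's \<Rightarrow> ennreal) \<Rightarrow> 's \<Rightarrow> 's \<Rightarrow> ennreal" where
  "hit_total A z x = (\<Sum>n. first_hit A z n x)"

text \<open>The unit column vector at \<open>y\<close>: \<open>(act A ^^ n) (point y) x\<close> is
  the entry of the \<open>n\<close>-th matrix power at \<open>(x, y)\<close>, and similarly for the
  taboo powers.\<close>

definition point :: "'s \<Rightarrow> 's \<Rightarrow> ennreal" where
  "point y x = (if x = y then 1 else 0)"

definition irreducible_act :: "('s \<Rightarrow> 's \<Rightarrow> ennreal) \<Rightarrow> bool" where
  "irreducible_act A \<longleftrightarrow> (\<forall>x y. \<exists>n\<ge>1. (act A ^^ n) (point y) x > 0)"

section \<open>Monotonicity and linearity of the two actions and of their iterates\<close>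

lemma act_mono: "(\<And>x. g x \<le> h x) \<Longrightarrow> act A g x \<le> act A h x"
  unfolding act_def by (intro nn_integral_mono mult_left_mono) auto

lemma act_add: "act A (\<lambda>w. g w + h w) = (\<lambda>x. act A g x + act A h x)"
  unfolding act_def by (auto simp: distrib_left nn_integral_add)

lemma act_cmult: "act A (\<lambda>w. c * h w) = (\<lambda>x. c * act A h x)"
proof
  fix x
  have "act A (\<lambda>w. c * h w) x = (\<integral>\<^sup>+ w. c * (A x w * h w) \<partial>count_space UNIV)"
    unfolding act_def by (simp add: mult_ac)
  also have "\<dots> = c * act A h x"
    unfolding act_def by (rule nn_integral_cmult) auto
  finally show "act A (\<lambda>w. c * h w) x = c * act A h x" .
qed

lemma act_zero: "act A (\<lambda>w. 0) = (\<lambda>x. 0)"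
  unfolding act_def by simp

lemma act_sum: "act A (\<lambda>w. \<Sum>i\<in>I. h i w) = (\<lambda>x. \<Sum>i\<in>I. act A (h i) x)"
  by (induction I rule: infinite_finite_induct) (simp_all add: act_zero act_add)

lemma act_suminf: "act A (\<lambda>w. \<Sum>i. h i w) = (\<lambda>x. \<Sum>i. act A (h i) x)"
  unfolding act_def by (simp add: nn_integral_suminf flip: ennreal_suminf_cmult)

lemma act_point: "act A (\<lambda>w. if w = z then c else 0) x = A x z * c"
proof -
  have "act A (\<lambda>w. if w = z then c else 0) x
      = (\<integral>\<^sup>+ w. A x w * c * indicator {z} w \<partial>count_space UNIV)"
    unfolding act_def by (intro nn_integral_cong) auto
  then show ?thesis by simp
qed

lemma act_taboo: "act A h x = taboo_act A z h x + A x z * h z"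
proof -
  have "h = (\<lambda>w. (if w = z then 0 else h w) + (if w = z then h z else 0))" by auto
  then have "act A h x
      = act A (\<lambda>w. (if w = z then 0 else h w) + (if w = z then h z else 0)) x" by simp
  then show ?thesis by (simp only: act_add act_point taboo_act_def)
qed

lemma taboo_act_mono: "(\<And>x. g x \<le> h x) \<Longrightarrow> taboo_act A z g x \<le> taboo_act A z h x"
  unfolding taboo_act_def by (intro act_mono) auto

lemma taboo_act_add: "taboo_act A z (\<lambda>w. g w + h w) = (\<lambda>x. taboo_act A z g x + taboo_act A z h x)"
proof -
  have "(\<lambda>w. if w = z then 0 else g w + h w)
      = (\<lambda>w. (if w = z then 0 else g w) + (if w = z then 0 else h w))" by auto
  then show ?thesis unfolding taboo_act_def by (simp add: act_add)
qed

lemma taboo_act_cmult: "taboo_act A z (\<lambda>w. c * h w) = (\<lambda>x. c * taboo_act A z h x)"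
proof -
  have "(\<lambda>w. if w = z then 0 else c * h w) = (\<lambda>w. c * (if w = z then 0 else h w))" by auto
  then show ?thesis unfolding taboo_act_def by (simp add: act_cmult)
qed

lemma taboo_act_sum: "taboo_act A z (\<lambda>w. \<Sum>i\<in>I. h i w) = (\<lambda>x. \<Sum>i\<in>I. taboo_act A z (h i) x)"
proof -
  have "(\<lambda>w. if w = z then 0 else \<Sum>i\<in>I. h i w) = (\<lambda>w. \<Sum>i\<in>I. if w = z then 0 else h i w)" by auto
  then show ?thesis unfolding taboo_act_def by (simp add: act_sum)
qed

lemma taboo_act_suminf: "taboo_act A z (\<lambda>w. \<Sum>i. h i w) = (\<lambda>x. \<Sum>i. taboo_act A z (h i) x)"
proof -
  have "(\<lambda>w. if w = z then 0 else \<Sum>i. h i w) = (\<lambda>w. \<Sum>i. if w = z then 0 else h i w)" by auto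
  then show ?thesis unfolding taboo_act_def by (simp add: act_suminf)
qed

lemma act_pow_mono: "(\<And>x. g x \<le> h x) \<Longrightarrow> (act A ^^ n) g x \<le> (act A ^^ n) h x"
  by (induction n arbitrary: x) (auto intro!: act_mono)

lemma act_pow_add: "(act A ^^ n) (\<lambda>w. g w + h w) = (\<lambda>x. (act A ^^ n) g x + (act A ^^ n) h x)"
  by (induction n) (simp_all add: act_add)

lemma act_pow_cmult: "(act A ^^ n) (\<lambda>w. c * h w) = (\<lambda>x. c * (act A ^^ n) h x)"
  by (induction n) (simp_all add: act_cmult)

lemma taboo_pow_mono: "(\<And>x. g x \<le> h x) \<Longrightarrow> (taboo_act A z ^^ n) g x \<le> (taboo_act A z ^^ n) h x"
  by (induction n arbitrary: x) (auto intro!: taboo_act_mono)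

lemma taboo_pow_cmult: "(taboo_act A z ^^ n) (\<lambda>w. c * h w) = (\<lambda>x. c * (taboo_act A z ^^ n) h x)"
  by (induction n) (simp_all add: taboo_act_cmult)

lemma taboo_pow_suminf:
  "(taboo_act A z ^^ n) (\<lambda>w. \<Sum>i. h i w) = (\<lambda>x. \<Sum>i. (taboo_act A z ^^ n) (h i) x)"
  by (induction n) (simp_all add: taboo_act_suminf)

text \<open>Paths that may not enter \<open>z\<close> cannot end there after at least one step. This
  removes the remainder of the first-entrance decomposition when the target is
  \<open>z\<close>.\<close>

lemma taboo_pow_point_self: "n \<ge> 1 \<Longrightarrow> (taboo_act A z ^^ n) (point z) x = 0"
proof (cases n)
  case (Suc k)
  have "taboo_act A z (point z) = (\<lambda>x. 0)"
  proof -
    have "(\<lambda>w. if w = z then 0 else point z w) = (\<lambda>w. 0)" by (auto simp: point_def)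
    then show ?thesis unfolding taboo_act_def by (simp add: act_zero)
  qed
  moreover have "(taboo_act A z ^^ k) (\<lambda>x. 0) = (\<lambda>x. 0)"
    by (induction k) (simp_all add: taboo_act_def[of A z "\<lambda>x. 0"] act_zero)
  ultimately show ?thesis using Suc by (simp add: funpow_swap1)
qed simp

lemma point_le: "h y * point y x \<le> h x"
  by (simp add: point_def)

section \<open>First entrances into \<open>z\<close> and uniqueness of fixed vectors\<close>

lemma taboo_pow_first_hit: "(taboo_act A z ^^ n) (first_hit A z i) = first_hit A z (n + i)"
  by (simp add: first_hit_def funpow_add)

lemma first_hit_Suc: "first_hit A z (Suc i) = taboo_act A z (first_hit A z i)"
  by (simp add: first_hit_def)

text \<open>Induction on the length, peeling off the first step: a step into \<open>z\<close> yields
  the term \<open>i = 0\<close>, and a step elsewhere delays each later first entrance by one. An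
  entrance at time \<open>i + 1\<close> leaves \<open>n - 1 - i\<close> steps.\<close>

lemma first_entrance:
  "(act A ^^ n) h x
   = (taboo_act A z ^^ n) h x + (\<Sum>i<n. first_hit A z i x * (act A ^^ (n - 1 - i)) h z)"
proof (induction n arbitrary: x)
  case (Suc n)
  let ?c = "\<lambda>i. (act A ^^ (n - 1 - i)) h z"
  have "(act A ^^ n) h = (\<lambda>x. (taboo_act A z ^^ n) h x + (\<Sum>i<n. ?c i * first_hit A z i x))"
    by (rule ext) (use Suc.IH in \<open>simp only: mult.commute\<close>)
  then have "taboo_act A z ((act A ^^ n) h) x
      = taboo_act A z (\<lambda>x. (taboo_act A z ^^ n) h x + (\<Sum>i<n. ?c i * first_hit A z i x)) x"
    by (rule arg_cong)
  also have "\<dots> = (taboo_act A z ^^ Suc n) h x + (\<Sum>i<n. ?c i * first_hit A z (Suc i) x)"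
    by (simp add: taboo_act_add taboo_act_sum taboo_act_cmult first_hit_Suc)
  finally have "(act A ^^ Suc n) h x = (taboo_act A z ^^ Suc n) h x
      + (\<Sum>i<n. first_hit A z (Suc i) x * ?c i) + A x z * (act A ^^ n) h z"
    by (simp add: act_taboo[where z = z] mult.commute)
  moreover have "(\<Sum>i<Suc n. first_hit A z i x * (act A ^^ (Suc n - 1 - i)) h z)
      = A x z * (act A ^^ n) h z
        + (\<Sum>i<n. first_hit A z (Suc i) x * (act A ^^ (n - 1 - i)) h z)"
    unfolding sum.lessThan_Suc_shift by (simp add: first_hit_def)
  ultimately show ?case by (simp add: add_ac)
qed simp

text \<open>A step away from \<open>z\<close> shifts the first-hit index by one. A step into
  \<open>z\<close> contributes \<open>A x z\<close> times the total at \<open>z\<close>, which is 1,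
  and so supplies exactly the missing term of index 0.\<close>

lemma act_hit_total:
  assumes "hit_total A z z = 1"
  shows "act A (hit_total A z) = hit_total A z"
proof
  fix x
  have "act A (hit_total A z) x = (\<Sum>i. first_hit A z (Suc i) x) + first_hit A z 0 x"
    using assms by (subst act_taboo[where z = z])
      (simp add: hit_total_def[abs_def] taboo_act_suminf first_hit_Suc, simp add: first_hit_def)
  also have "\<dots> = hit_total A z x"
    unfolding hit_total_def using suminf_offset[of "\<lambda>n. first_hit A z n x" 1]
    by (simp add: summableI add.commute)
  finally show "act A (hit_total A z) x = hit_total A z x" .
qed

text \<open>The taboo remainder vanishes for the target \<open>z\<close>, so a positive power entry
  must come from some first entrance.\<close>

lemma first_hit_reachable:
  assumes "irreducible_act A"
  obtains n where "first_hit A z n x > 0"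
proof -
  obtain n where n: "n \<ge> 1" "(act A ^^ n) (point z) x > 0"
    using assms unfolding irreducible_act_def by blast
  then have "(\<Sum>i<n. first_hit A z i x * (act A ^^ (n - 1 - i)) (point z) z) \<noteq> 0"
    unfolding first_entrance[of n A "point z" x z] by (simp only: taboo_pow_point_self add_0_left less_irrefl not_False_eq_True zero_less_iff_neq_zero)
  then obtain i where "first_hit A z i x * (act A ^^ (n - 1 - i)) (point z) z \<noteq> 0"
    by (meson sum.neutral)
  then have "first_hit A z i x \<noteq> 0" by auto
  then show ?thesis using that by (auto simp: zero_less_iff_neq_zero)
qed

text \<open>A shortest path of positive weight from \<open>z\<close> to \<open>x\<close> does not
  revisit \<open>z\<close>: for the least length, every first-entrance term contains a power entry
  of smaller length, hence zero.\<close>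

lemma taboo_reachable:
  assumes "irreducible_act A"
  obtains n where "(taboo_act A z ^^ n) (point x) z > 0"
proof (cases "x = z")
  case True
  then show ?thesis using that[of 0] by (simp add: point_def)
next
  case False
  define P where "P n \<longleftrightarrow> (act A ^^ n) (point x) z > 0" for n
  have "\<exists>n. P n" using assms unfolding irreducible_act_def P_def by blast
  then have least: "P (LEAST n. P n)" by (rule LeastI_ex)
  define n where "n = (LEAST n. P n)"
  have "(act A ^^ (n - 1 - i)) (point x) z = 0" if "i < n" for i
  proof -
    have "n - 1 - i < (LEAST n. P n)" using that unfolding n_def[symmetric] by linarith
    then have "\<not> P (n - 1 - i)" by (rule not_less_Least)
    then show ?thesis by (simp only: P_def not_gr_zero)
  qed
  then have "(\<Sum>i<n. first_hit A z i z * (act A ^^ (n - 1 - i)) (point x) z) = 0"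
    by (intro sum.neutral ballI) simp
  then have "(act A ^^ n) (point x) z = (taboo_act A z ^^ n) (point x) z"
    by (subst first_entrance[where z = z]) (simp only: add_0_right)
  moreover have "(act A ^^ n) (point x) z > 0" using least unfolding n_def[symmetric] by (simp only: P_def)
  ultimately have "(taboo_act A z ^^ n) (point x) z > 0" by simp
  then show ?thesis using that by blast
qed

text \<open>Some excursion from \<open>z\<close> reaches \<open>x\<close> with positive weight
  before returning. Continuing it from \<open>x\<close> to \<open>z\<close> produces only returns to
  \<open>z\<close>, whose total weight is 1, so the total at \<open>x\<close> cannot be
  infinite.\<close>

lemma hit_total_finite:
  assumes "irreducible_act A" and "hit_total A z z = 1"
  shows "hit_total A z x < \<infinity>"
proof -
  obtain n where n: "(taboo_act A z ^^ n) (point x) z > 0"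
    using taboo_reachable[OF assms(1)] by blast
  have "hit_total A z x * (taboo_act A z ^^ n) (point x) z
      = (taboo_act A z ^^ n) (\<lambda>w. hit_total A z x * point x w) z"
    by (simp add: taboo_pow_cmult)
  also have "\<dots> \<le> (taboo_act A z ^^ n) (hit_total A z) z"
    by (intro taboo_pow_mono point_le)
  also have "\<dots> = (\<Sum>i. first_hit A z (n + i) z)"
    by (simp add: hit_total_def[abs_def] taboo_pow_suminf taboo_pow_first_hit)
  also have "\<dots> \<le> hit_total A z z"
    unfolding hit_total_def
    using suminf_offset[of "\<lambda>i. first_hit A z i z" n] by (simp add: summableI add.commute)
  finally have "hit_total A z x * (taboo_act A z ^^ n) (point x) z \<le> 1" using assms by simp
  with n show ?thesis
    by (cases "hit_total A z x = \<infinity>") (auto simp: ennreal_top_mult less_top top_unique split: if_splits)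
qed

text \<open>Some \<open>i\<close> has positive first-hit weight from \<open>y\<close>. Continuing
  each taboo path from \<open>x\<close> to \<open>y\<close> by these first hits bounds the sum, up
  to this positive factor, by the finite total at \<open>x\<close>.\<close>

lemma taboo_pow_point_summable:
  assumes "irreducible_act A" and "hit_total A z z = 1"
  shows "(\<Sum>n. (taboo_act A z ^^ n) (point y) x) < \<infinity>"
proof -
  obtain i where i: "first_hit A z i y > 0"
    using first_hit_reachable[OF assms(1)] by blast
  have "first_hit A z i y * (taboo_act A z ^^ n) (point y) x \<le> first_hit A z (n + i) x" for n
  proof -
    have "first_hit A z i y * (taboo_act A z ^^ n) (point y) x
        = (taboo_act A z ^^ n) (\<lambda>w. first_hit A z i y * point y w) x"
      by (simp add: taboo_pow_cmult)
    also have "\<dots> \<le> (taboo_act A z ^^ n) (first_hit A z i) x"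
      by (intro taboo_pow_mono point_le)
    finally show ?thesis by (simp add: taboo_pow_first_hit)
  qed
  then have "first_hit A z i y * (\<Sum>n. (taboo_act A z ^^ n) (point y) x)
      \<le> (\<Sum>n. first_hit A z (n + i) x)"
    by (simp add: suminf_le summableI flip: ennreal_suminf_cmult)
  also have "\<dots> \<le> hit_total A z x"
    unfolding hit_total_def
    using suminf_offset[of "\<lambda>n. first_hit A z n x" i] by (simp add: summableI)
  also have "\<dots> < \<infinity>" by (rule hit_total_finite[OF assms])
  finally show ?thesis using i
    by (cases "(\<Sum>n. (taboo_act A z ^^ n) (point y) x) = \<infinity>")
      (auto simp: ennreal_mult_top less_top split: if_splits)
qed

lemma eigenvector_unique:
  assumes irr: "irreducible_act A" and one: "hit_total A z z = 1"
    and eig: "act A u = u" and fin: "\<And>x. u x < \<infinity>"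
  shows "u x = u z * hit_total A z x"
proof -
  have pow: "(act A ^^ n) u = u" for n by (induction n) (simp_all add: eig)
  have "(\<Sum>i<n. first_hit A z i y * u z) \<le> u y" for n y
    using first_entrance[of n A u y z] by (simp add: pow)
  then have "(\<Sum>i. first_hit A z i y * u z) \<le> u y" for y
    by (intro suminf_le_const summableI)
  then have ge: "u z * hit_total A z y \<le> u y" for y
    unfolding hit_total_def by (simp add: mult.commute)
  \<comment> \<open>Subtraction of extended nonnegative reals is truncated; \<open>ge\<close> makes
    \<open>d\<close> the genuine excess of \<open>u\<close>.\<close>
  define d where "d y = u y - u z * hit_total A z y" for y
  have split: "u = (\<lambda>y. u z * hit_total A z y + d y)"
    using ge by (simp add: d_def add_diff_inverse_ennreal)
  obtain n where n: "(act A ^^ n) (point x) z > 0"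
    using irr unfolding irreducible_act_def by blast
  have hit: "(act A ^^ n) (hit_total A z) = hit_total A z"
    by (induction n) (simp_all add: act_hit_total[OF one])
  \<comment> \<open>Both fixed vectors take the value \<open>u z\<close> at \<open>z\<close>, so the
    \<open>n\<close>-th iterate of \<open>d\<close> vanishes there once the finite
    \<open>u z\<close> is cancelled. A path from \<open>z\<close> to \<open>x\<close> then carries
    this back to \<open>d x = 0\<close>.\<close>
  have "u z = (act A ^^ n) u z" by (simp add: pow)
  also have "\<dots> = (act A ^^ n) (\<lambda>y. u z * hit_total A z y + d y) z"
    by (rule arg_cong[where f = "\<lambda>v. (act A ^^ n) v z", OF split])
  also have "\<dots> = u z + (act A ^^ n) d z"
    by (simp add: act_pow_add act_pow_cmult hit one)
  finally have "(act A ^^ n) d z = 0"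
    using fin[of z] ennreal_add_left_cancel[of "u z" 0 "(act A ^^ n) d z"] by auto
  moreover have "d x * (act A ^^ n) (point x) z \<le> (act A ^^ n) d z"
    using act_pow_mono[of "\<lambda>w. d x * point x w" d n A z] by (simp add: act_pow_cmult point_le)
  ultimately have "d x = 0" using n by auto
  then show ?thesis using fun_cong[OF split, of x] by simp
qed

section \<open>Transposition, reversal of excursions, and the pairing of the two
  eigenvectors\<close>

lemma nn_integral_count_space_swap:
  fixes f :: "'a::countable \<Rightarrow> 'b::countable \<Rightarrow> ennreal"
  shows "(\<integral>\<^sup>+ x. \<integral>\<^sup>+ y. f x y \<partial>count_space UNIV \<partial>count_space UNIV)
       = (\<integral>\<^sup>+ y. \<integral>\<^sup>+ x. f x y \<partial>count_space UNIV \<partial>count_space UNIV)"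
  by (intro nn_integral_count_space_nn_integral) auto

lemma act_transpose:
  fixes A :: "'s::countable \<Rightarrow> 's \<Rightarrow> ennreal"
  shows "(\<integral>\<^sup>+ y. act (\<lambda>x y. A y x) g y * h y \<partial>count_space UNIV)
       = (\<integral>\<^sup>+ y. g y * act A h y \<partial>count_space UNIV)"
proof -
  have "(\<integral>\<^sup>+ y. act (\<lambda>x y. A y x) g y * h y \<partial>count_space UNIV)
      = (\<integral>\<^sup>+ y. \<integral>\<^sup>+ w. A w y * g w * h y \<partial>count_space UNIV \<partial>count_space UNIV)"
    unfolding act_def by (simp add: nn_integral_multc)
  also have "\<dots> = (\<integral>\<^sup>+ w. \<integral>\<^sup>+ y. g w * (A w y * h y) \<partial>count_space UNIV \<partial>count_space UNIV)"
    by (subst nn_integral_count_space_swap) (simp add: mult_ac)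
  also have "\<dots> = (\<integral>\<^sup>+ y. g y * act A h y \<partial>count_space UNIV)"
    unfolding act_def by (simp add: nn_integral_cmult)
  finally show ?thesis .
qed

lemma act_pow_transpose:
  fixes A :: "'s::countable \<Rightarrow> 's \<Rightarrow> ennreal"
  shows "(\<integral>\<^sup>+ y. (act (\<lambda>x y. A y x) ^^ n) g y * h y \<partial>count_space UNIV)
       = (\<integral>\<^sup>+ y. g y * (act A ^^ n) h y \<partial>count_space UNIV)"
proof (induction n arbitrary: h)
  case (Suc n)
  have "(\<integral>\<^sup>+ y. (act (\<lambda>x y. A y x) ^^ Suc n) g y * h y \<partial>count_space UNIV)
      = (\<integral>\<^sup>+ y. (act (\<lambda>x y. A y x) ^^ n) g y * act A h y \<partial>count_space UNIV)"
    by (simp add: act_transpose)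
  then show ?case by (simp add: Suc.IH funpow_swap1)
qed simp

lemma nn_integral_point:
  "(\<integral>\<^sup>+ y. point x y * h y \<partial>count_space UNIV) = h x"
  "(\<integral>\<^sup>+ y. h y * point x y \<partial>count_space UNIV) = h x"
proof -
  have "(\<integral>\<^sup>+ y. h y * point x y \<partial>count_space UNIV)
      = (\<integral>\<^sup>+ y. h y * indicator {x} y \<partial>count_space UNIV)"
    by (intro nn_integral_cong) (auto simp: point_def)
  then show "(\<integral>\<^sup>+ y. h y * point x y \<partial>count_space UNIV) = h x" by simp
  then show "(\<integral>\<^sup>+ y. point x y * h y \<partial>count_space UNIV) = h x" by (simp add: mult.commute)
qed

lemma act_pow_point_transpose:
  fixes A :: "'s::countable \<Rightarrow> 's \<Rightarrow> ennreal"
  shows "(act (\<lambda>x y. A y x) ^^ n) (point x) y = (act A ^^ n) (point y) x"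
  using act_pow_transpose[where A = A and n = n and g = "point x" and h = "point y"] by (simp add: nn_integral_point)

lemma irreducible_transpose:
  fixes A :: "'s::countable \<Rightarrow> 's \<Rightarrow> ennreal"
  assumes "irreducible_act A"
  shows "irreducible_act (\<lambda>x y. A y x)"
  using assms unfolding irreducible_act_def by (simp add: act_pow_point_transpose[where A = A])

text \<open>The values \<open>(taboo_act A z ^^ n) (point y) x\<close> are the matrix entries of the
  iterated taboo action, and they determine it on every vector.\<close>

lemma taboo_pow_dual:
  fixes A :: "'s::countable \<Rightarrow> 's \<Rightarrow> ennreal"
  shows "(\<integral>\<^sup>+ y. (taboo_act A z ^^ n) (point y) x * h y \<partial>count_space UNIV)
       = (taboo_act A z ^^ n) h x"
proof (induction n arbitrary: x)
  case 0
  have "(\<integral>\<^sup>+ y. point y x * h y \<partial>count_space UNIV) = (\<integral>\<^sup>+ y. point x y * h y \<partial>count_space UNIV)"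
    by (intro nn_integral_cong) (auto simp: point_def)
  then show ?case by (simp add: nn_integral_point)
next
  case (Suc n)
  let ?K = "\<lambda>y w. (taboo_act A z ^^ n) (point y) w"
  have "(\<integral>\<^sup>+ y. (taboo_act A z ^^ Suc n) (point y) x * h y \<partial>count_space UNIV)
     = (\<integral>\<^sup>+ y. \<integral>\<^sup>+ w. (A x w * (if w = z then 0 else ?K y w)) * h y
          \<partial>count_space UNIV \<partial>count_space UNIV)"
    by (simp add: taboo_act_def act_def nn_integral_multc)
  also have "\<dots> = (\<integral>\<^sup>+ w. \<integral>\<^sup>+ y. A x w * (if w = z then 0 else 1) * (?K y w * h y)
          \<partial>count_space UNIV \<partial>count_space UNIV)"
    by (subst nn_integral_count_space_swap) (auto intro!: nn_integral_cong simp: mult_ac)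
  also have "\<dots> = (\<integral>\<^sup>+ w. A x w * (if w = z then 0 else 1) * (taboo_act A z ^^ n) h w
          \<partial>count_space UNIV)"
    by (simp add: nn_integral_cmult Suc.IH)
  also have "\<dots> = (taboo_act A z ^^ Suc n) h x"
    unfolding funpow.simps o_apply taboo_act_def[of A z "(taboo_act A z ^^ n) h"] act_def
    by (intro nn_integral_cong) auto
  finally show ?case .
qed

text \<open>Iterating the definition adds a step at the start of the path; here the last step is
  split off instead. This is the form that matches path reversal and the forward evolution of the
  chain.\<close>

lemma taboo_pow_point_Suc:
  fixes A :: "'s::countable \<Rightarrow> 's \<Rightarrow> ennreal"
  shows "(taboo_act A z ^^ Suc n) (point y) x = (if y = z then 0 else
           (\<integral>\<^sup>+ w. (taboo_act A z ^^ n) (point w) x * A w y \<partial>count_space UNIV))"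
proof -
  have "(taboo_act A z ^^ Suc n) (point y) x = (taboo_act A z ^^ n) (taboo_act A z (point y)) x"
    by (simp add: funpow_swap1)
  also have "\<dots> = (\<integral>\<^sup>+ w. (taboo_act A z ^^ n) (point w) x * taboo_act A z (point y) w
      \<partial>count_space UNIV)"
    by (simp add: taboo_pow_dual)
  also have "taboo_act A z (point y) = (\<lambda>w. if y = z then 0 else A w y)"
  proof
    fix w
    have "(\<lambda>w. if w = z then 0 else point y w) = (\<lambda>w. if w = y then (if y = z then 0 else 1) else 0)"
      by (auto simp: point_def)
    then show "taboo_act A z (point y) w = (if y = z then 0 else A w y)"
      unfolding taboo_act_def by (simp add: act_point)
  qed
  finally show ?thesis by simp
qed

text \<open>Read backwards, a path of the transposed matrix from \<open>y\<close> that first hits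
  \<open>z\<close> at time \<open>n + 1\<close> starts at \<open>z\<close>, avoids \<open>z\<close>
  for \<open>n\<close> steps, and then steps into \<open>y\<close>.\<close>

lemma first_hit_transpose:
  fixes A :: "'s::countable \<Rightarrow> 's \<Rightarrow> ennreal"
  shows "first_hit (\<lambda>x y. A y x) z n y
       = (\<integral>\<^sup>+ w. (taboo_act A z ^^ n) (point w) z * A w y \<partial>count_space UNIV)"
proof (induction n arbitrary: y)
  case 0
  show ?case using taboo_pow_dual[where A = A and z = z and n = 0 and x = z and h = "\<lambda>w. A w y"] by (simp add: first_hit_def)
next
  case (Suc n)
  have "first_hit (\<lambda>x y. A y x) z (Suc n) y = (\<integral>\<^sup>+ w. A w y *
      (if w = z then 0 else first_hit (\<lambda>x y. A y x) z n w) \<partial>count_space UNIV)"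
    by (simp add: first_hit_Suc taboo_act_def act_def)
  also have "\<dots> = (\<integral>\<^sup>+ w. (taboo_act A z ^^ Suc n) (point w) z * A w y \<partial>count_space UNIV)"
    by (intro nn_integral_cong) (simp add: Suc.IH taboo_pow_point_Suc mult.commute del: funpow.simps)
  finally show ?case .
qed

text \<open>Reversing an excursion from \<open>z\<close> to \<open>z\<close> gives another one of
  the same length and weight, so the normalisation and the finite mean carry over to the transposed
  matrix.\<close>

lemma first_hit_transpose_self:
  fixes A :: "'s::countable \<Rightarrow> 's \<Rightarrow> ennreal"
  shows "first_hit (\<lambda>x y. A y x) z n z = first_hit A z n z"
  by (subst first_hit_transpose) (simp add: taboo_pow_dual first_hit_def)

text \<open>The left side is the weighted number of visits to \<open>y\<close> during an excursion
  from \<open>z\<close>. For \<open>y\<close> other than \<open>z\<close> this is reversal with the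
  index shifted by one; for \<open>y = z\<close> only time 0 counts, giving 1, which the assumption
  matches.\<close>

lemma taboo_total_eq:
  fixes A :: "'s::countable \<Rightarrow> 's \<Rightarrow> ennreal"
  assumes "hit_total A z z = 1"
  shows "(\<Sum>n. (taboo_act A z ^^ n) (point y) z) = hit_total (\<lambda>x y. A y x) z y"
proof -
  have "(\<Sum>n. (taboo_act A z ^^ n) (point y) z)
      = (\<Sum>n. (taboo_act A z ^^ Suc n) (point y) z) + point y z"
    using suminf_offset[of "\<lambda>n. (taboo_act A z ^^ n) (point y) z" 1] by (simp add: summableI)
  also have "(\<lambda>n. (taboo_act A z ^^ Suc n) (point y) z)
      = (\<lambda>n. if y = z then 0 else first_hit (\<lambda>x y. A y x) z n y)"
    by (simp only: taboo_pow_point_Suc first_hit_transpose[where A = A])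
  also have "(\<Sum>n. if y = z then 0 else first_hit (\<lambda>x y. A y x) z n y) + point y z
      = hit_total (\<lambda>x y. A y x) z y"
    using assms by (auto simp: point_def hit_total_def first_hit_transpose_self[where A = A])
  finally show ?thesis .
qed

text \<open>Each \<open>k\<close> arises as \<open>j + i\<close> for exactly \<open>k + 1\<close>
  values of \<open>j\<close>.\<close>

lemma suminf_triangle_ennreal:
  fixes f :: "nat \<Rightarrow> ennreal"
  shows "(\<Sum>j. \<Sum>i. f (j + i)) = (\<Sum>k. of_nat (Suc k) * f k)"
proof -
  have "(\<Sum>j. \<Sum>i. f (j + i)) = (\<Sum>j. \<Sum>k. if j \<le> k then f k else 0)"
  proof (rule suminf_cong)
    fix j
    have "(\<Sum>k. if j \<le> k then f k else 0)
        = (\<Sum>i. if j \<le> i + j then f (i + j) else 0) + (\<Sum>k<j. if j \<le> k then f k else 0)"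
      by (rule suminf_offset) (simp add: summableI)
    then show "(\<Sum>i. f (j + i)) = (\<Sum>k. if j \<le> k then f k else 0)" by (simp add: add.commute)
  qed
  also have "\<dots> = (\<Sum>k. \<Sum>j. if j \<le> k then f k else 0)"
    using nn_integral_count_space_swap[of "\<lambda>j k. if j \<le> k then f k else 0"]
    by (simp add: nn_integral_count_space_nat)
  also have "\<dots> = (\<Sum>k. of_nat (Suc k) * f k)"
  proof (rule suminf_cong)
    fix k
    show "(\<Sum>j. if j \<le> k then f k else 0) = of_nat (Suc k) * f k"
      using suminf_finite[of "{..k}" "\<lambda>j. if j \<le> k then f k else 0"] by simp
  qed
  finally show ?thesis .
qed

text \<open>A return path of length \<open>k + 1\<close> may be cut at any time \<open>j\<close>
  from 0 to \<open>k\<close>; the part before the cut is a visit during the excursion and the part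
  after it a first hit of \<open>z\<close>.\<close>

lemma pairing_eq:
  fixes A :: "'s::countable \<Rightarrow> 's \<Rightarrow> ennreal"
  assumes "hit_total A z z = 1"
  shows "(\<integral>\<^sup>+ w. hit_total (\<lambda>x y. A y x) z w * hit_total A z w \<partial>count_space UNIV)
       = (\<Sum>k. of_nat (Suc k) * first_hit A z k z)"
proof -
  have "(\<integral>\<^sup>+ w. hit_total (\<lambda>x y. A y x) z w * hit_total A z w \<partial>count_space UNIV)
      = (\<Sum>n. \<integral>\<^sup>+ w. (taboo_act A z ^^ n) (point w) z * hit_total A z w \<partial>count_space UNIV)"
    unfolding taboo_total_eq[OF assms, symmetric]
    by (subst nn_integral_suminf[symmetric]) (simp_all flip: ennreal_suminf_multc)
  also have "\<dots> = (\<Sum>j. \<Sum>i. first_hit A z (j + i) z)"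
    unfolding taboo_pow_dual by (simp add: hit_total_def[abs_def] taboo_pow_suminf taboo_pow_first_hit)
  finally show ?thesis using suminf_triangle_ennreal[of "\<lambda>k. first_hit A z k z"] by simp
qed

section \<open>The renewal theorem\<close>

lemma bounded_limsup_subseq:
  fixes g :: "nat \<Rightarrow> real"
  assumes "\<And>n. \<bar>g n\<bar> \<le> M"
  obtains l r where "strict_mono r" "(\<lambda>k. g (r k)) \<longlonglongrightarrow> l"
    "\<And>e. e > 0 \<Longrightarrow> \<forall>\<^sub>F n in sequentially. g n < l + e"
proof -
  let ?L = "limsup (\<lambda>n. ereal (g n))"
  have "?L \<le> ereal M"
    using assms by (intro Limsup_bounded always_eventually) (auto simp: abs_le_iff)
  moreover have "ereal (- M) \<le> liminf (\<lambda>n. ereal (g n))"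
    using assms by (intro Liminf_bounded always_eventually) (auto simp: abs_le_iff minus_le_iff)
  moreover have "liminf (\<lambda>n. ereal (g n)) \<le> ?L" by (intro Liminf_le_Limsup) simp
  ultimately have "\<bar>?L\<bar> \<noteq> \<infinity>" by auto
  then obtain l where l: "?L = ereal l" by auto
  obtain r where r: "strict_mono r" "((\<lambda>n. ereal (g n)) \<circ> r) \<longlonglongrightarrow> ?L"
    using limsup_subseq_lim by blast
  have "\<forall>\<^sub>F n in sequentially. g n < l + e" if "e > 0" for e
  proof -
    have "?L < ereal (l + e)" using l that by simp
    then show ?thesis using Limsup_lessD by fastforce
  qed
  moreover have "(\<lambda>k. g (r k)) \<longlonglongrightarrow> l" using r(2) by (simp add: l o_def)
  ultimately show ?thesis using that r(1) by blast
qed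

text \<open>The least positive difference \<open>d\<close> between two elements \<open>s\<close> and
  \<open>s + d\<close> divides every element, since a nonzero remainder would be a smaller
  difference. Hence \<open>d = p\<close>, and sums of copies of \<open>s\<close> and
  \<open>s + p\<close> cover all large multiples of \<open>p\<close>.\<close>

lemma add_closed_eventually_multiples:
  fixes S :: "nat set"
  assumes closed: "\<And>a b. a \<in> S \<Longrightarrow> b \<in> S \<Longrightarrow> a + b \<in> S"
    and pos: "\<And>a. a \<in> S \<Longrightarrow> a > 0" and gcd: "Gcd S = p" and p: "p > 0"
  obtains N where "\<And>n. n \<ge> N \<Longrightarrow> p dvd n \<Longrightarrow> n \<in> S"
proof -
  have plus_mult: "a + k * b \<in> S" if "a \<in> S" "b \<in> S" for a b k
  proof (induction k)
    case (Suc k)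
    then show ?case using closed[OF Suc that(2)] by (simp add: algebra_simps)
  qed (simp add: that)
  have "S \<noteq> {}" using gcd p by auto
  then obtain s0 where s0: "s0 \<in> S" by blast
  define D where "D d \<longleftrightarrow> d > 0 \<and> (\<exists>s\<in>S. s + d \<in> S)" for d
  have "D s0" unfolding D_def using s0 pos closed by blast
  define d where "d = (LEAST d. D d)"
  have "D d" unfolding d_def using \<open>D s0\<close> by (rule LeastI)
  then obtain s where d: "d > 0" and s: "s \<in> S" "s + d \<in> S" unfolding D_def by blast
  have "d dvd t" if t: "t \<in> S" for t
  proof (rule ccontr)
    assume "\<not> d dvd t"
    then have r: "t mod d > 0" by (simp add: mod_greater_zero_iff_not_dvd)
    let ?q = "t div d"
    \<comment> \<open>These two elements of \<open>S\<close> differ by exactly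
      \<open>t mod d\<close>.\<close>
    have "s + ?q * (s + d) \<in> S" "(s + t) + ?q * s \<in> S"
      using plus_mult closed s t by blast+
    moreover have "(s + t) + ?q * s = (s + ?q * (s + d)) + t mod d"
      by (simp add: algebra_simps)
    ultimately have "D (t mod d)" unfolding D_def using r by metis
    then have "d \<le> t mod d" unfolding d_def by (rule Least_le)
    then show False using mod_less_divisor[OF d, of t] by linarith
  qed
  then have "d dvd p" using gcd by (auto intro: Gcd_greatest)
  moreover have "p dvd d" using s gcd by (metis Gcd_dvd dvd_add_right_iff)
  ultimately have dp: "d = p" by (rule dvd_antisym)
  obtain \<sigma> where \<sigma>: "s = p * \<sigma>" using s(1) gcd by (metis Gcd_dvd dvdE)
  \<comment> \<open>For \<open>n = p * k\<close> the bound \<open>s * s\<close> forces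
    \<open>\<sigma> * \<sigma> \<le> k\<close>, so the quotient of \<open>k\<close> by
    \<open>\<sigma>\<close> exceeds the remainder. With remainder \<open>\<rho>\<close>,
    \<open>n\<close> consists of \<open>\<rho>\<close> copies of \<open>s + p\<close> and the
    remaining copies of \<open>s\<close>.\<close>
  have "n \<in> S" if n: "n \<ge> s * s" "p dvd n" for n
  proof -
    obtain k where k: "n = p * k" using n(2) by blast
    have \<sigma>0: "\<sigma> > 0" using pos[OF s(1)] \<sigma> by auto
    have "\<sigma> * \<sigma> \<le> k"
    proof -
      have "p * (\<sigma> * \<sigma>) \<le> p * (\<sigma> * \<sigma>) * p" using p by simp
      also have "\<dots> = s * s" by (simp add: \<sigma>)
      also have "\<dots> \<le> p * k" using n k by simp
      finally show ?thesis using p by simp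
    qed
    then have "\<sigma> \<le> k div \<sigma>" using \<sigma>0 by (simp add: less_eq_div_iff_mult_less_eq)
    then have "k mod \<sigma> < k div \<sigma>" using \<sigma>0 by (meson mod_less_divisor less_le_trans)
    \<comment> \<open>Writing the surplus as \<open>Suc t\<close> leaves at least one copy of
      \<open>s\<close>, so the sum is not empty.\<close>
    then obtain t where t: "k div \<sigma> = k mod \<sigma> + Suc t" using less_imp_Suc_add by fastforce
    obtain \<rho> where "k = (\<rho> + Suc t) * \<sigma> + \<rho>"
      using t div_mult_mod_eq[of k \<sigma>] by metis
    then have "n = (s + t * s) + \<rho> * (s + p)"
      unfolding k \<sigma> by (simp add: algebra_simps)
    moreover have "s + p \<in> S" using s(2) dp by simp
    ultimately show ?thesis using plus_mult[OF plus_mult[OF s(1) s(1)]] by simp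
  qed
  then show ?thesis using that by blast
qed

text \<open>Tannery's theorem with dominating series \<open>q l * M\<close>. A general
  \<open>N\<close> in place of the identity allows limits along subsequences.\<close>

lemma convolution_tendsto:
  fixes q h :: "nat \<Rightarrow> real" and N :: "nat \<Rightarrow> nat"
  assumes q: "\<And>l. q l \<ge> 0" "q sums G" and h: "\<And>n. \<bar>h n\<bar> \<le> M"
    and N: "filterlim N at_top sequentially"
    and lim: "\<And>l. (\<lambda>k. h (N k - l)) \<longlonglongrightarrow> L"
  shows "(\<lambda>k. \<Sum>l\<le>N k. q l * h (N k - l)) \<longlonglongrightarrow> G * L"
proof -
  let ?c = "\<lambda>l k. if l \<le> N k then q l * h (N k - l) else 0"
  have M: "M \<ge> 0" using h[of 0] by linarith
  have "(\<lambda>k. \<Sum>l. ?c l k) \<longlonglongrightarrow> (\<Sum>l. q l * L)"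
  proof (rule tannerys_theorem[THEN conjunct2, THEN conjunct2])
    fix l
    have "\<forall>\<^sub>F k in sequentially. l \<le> N k" using N by (simp add: filterlim_at_top)
    then have "\<forall>\<^sub>F k in sequentially. q l * h (N k - l) = ?c l k" by eventually_elim simp
    moreover have "(\<lambda>k. q l * h (N k - l)) \<longlonglongrightarrow> q l * L"
      by (intro tendsto_mult tendsto_const lim)
    ultimately show "(\<lambda>k. ?c l k) \<longlonglongrightarrow> q l * L" by (rule Lim_transform_eventually[rotated])
  next
    show "\<forall>\<^sub>F (l, k) in at_top \<times>\<^sub>F sequentially. norm (?c l k) \<le> q l * M"
      using q h M by (intro always_eventually) (auto simp: abs_mult intro!: mult_left_mono)
    show "summable (\<lambda>l. q l * M)" using q by (intro summable_mult2) (auto simp: sums_iff)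
  qed simp
  moreover have "(\<Sum>l. ?c l k) = (\<Sum>l\<le>N k. q l * h (N k - l))" for k
    by (subst suminf_finite[of "{..N k}"]) auto
  moreover have "(\<Sum>l. q l * L) = G * L"
    using sums_mult2[OF q(2), of L] by (simp add: sums_iff)
  ultimately show ?thesis by simp
qed

text \<open>The mean of the \<open>p\<close> terms ending at index \<open>n\<close>, where terms of
  negative index count as 0.\<close>

definition window_avg :: "nat \<Rightarrow> (nat \<Rightarrow> real) \<Rightarrow> nat \<Rightarrow> real" where
  "window_avg p t n = (\<Sum>i<p. if i \<le> n then t (n - i) else 0) / real p"

text \<open>Averaging commutes with convolution. Padding by zero truncates the inner sums correctly,
  and \<open>Suc n \<ge> p\<close> makes every shift \<open>i < p\<close> at most
  \<open>n\<close>.\<close>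

lemma window_avg_convolution:
  assumes "Suc n \<ge> p"
  shows "(\<Sum>j\<le>n. q j * window_avg p t (n - j))
       = (\<Sum>i<p. \<Sum>j\<le>n - i. q j * t (n - i - j)) / real p"
proof -
  have "(\<Sum>j\<le>n. q j * window_avg p t (n - j))
      = (\<Sum>j\<le>n. \<Sum>i<p. if i \<le> n - j then q j * t (n - j - i) else 0) / real p"
    unfolding window_avg_def
    unfolding sum_divide_distrib sum_distrib_left by (intro sum.cong refl) simp
  also have "(\<Sum>j\<le>n. \<Sum>i<p. if i \<le> n - j then q j * t (n - j - i) else 0)
      = (\<Sum>i<p. \<Sum>j\<le>n. if i \<le> n - j then q j * t (n - j - i) else 0)"
    by (rule sum.swap)
  also have "\<dots> = (\<Sum>i<p. \<Sum>j\<le>n - i. q j * t (n - i - j))"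
  proof (rule sum.cong[OF refl])
    fix i assume "i \<in> {..<p}"
    then have "i \<le> n" using assms by auto
    then have "{j \<in> {..n}. i \<le> n - j} = {..n - i}" by auto
    then show "(\<Sum>j\<le>n. if i \<le> n - j then q j * t (n - j - i) else 0)
        = (\<Sum>j\<le>n - i. q j * t (n - i - j))"
      by (simp add: sum.inter_filter[symmetric] add.commute)
  qed
  finally show ?thesis .
qed

lemma window_avg_Suc:
  assumes "Suc n \<ge> p"
  shows "window_avg p t (Suc n) = (\<Sum>i<p. t (Suc (n - i))) / real p"
  unfolding window_avg_def using assms
  by (intro arg_cong[where f = "\<lambda>s. s / real p"] sum.cong) (auto simp: Suc_diff_le)

lemma window_avg_bounded:
  assumes "\<And>n. \<bar>t n\<bar> \<le> M" and "p > 0"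
  shows "\<bar>window_avg p t n\<bar> \<le> M"
proof -
  have M: "M \<ge> 0" using assms(1)[of 0] by linarith
  have "\<bar>\<Sum>i<p. if i \<le> n then t (n - i) else 0\<bar> \<le> (\<Sum>i<p. M)"
    using assms M by (intro order.trans[OF sum_abs] sum_mono) auto
  then show ?thesis using assms(2) by (simp add: window_avg_def divide_le_eq mult.commute)
qed

lemma filterlim_diff_const:
  assumes "filterlim (N :: nat \<Rightarrow> nat) at_top sequentially"
  shows "filterlim (\<lambda>k. N k - l) at_top sequentially"
proof (subst filterlim_at_top, safe)
  fix Z
  have "\<forall>\<^sub>F k in sequentially. Z + l \<le> N k" using assms by (simp add: filterlim_at_top)
  then show "\<forall>\<^sub>F k in sequentially. Z \<le> N k - l" by eventually_elim simp
qed

text \<open>If \<open>s\<close> is a convolution of \<open>t\<close> with a series of total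
  \<open>G\<close> plus a vanishing term, its window averages tend to \<open>G\<close> times the
  limit for \<open>t\<close>. It serves both the last-exit and the first-entrance
  decomposition.\<close>

lemma window_avg_renewal_tendsto:
  assumes q: "\<And>i. q i \<ge> 0" "q sums G" and t: "\<And>n. \<bar>t n\<bar> \<le> M"
    and lim: "window_avg p t \<longlonglongrightarrow> L" and k: "k \<longlonglongrightarrow> 0" and p: "p > 0"
    and s: "\<And>n. s (Suc n) = k (Suc n) + (\<Sum>i\<le>n. q i * t (n - i))"
  shows "window_avg p s \<longlonglongrightarrow> G * L"
proof -
  have "(\<lambda>n. \<Sum>j\<le>n. q j * window_avg p t (n - j)) \<longlonglongrightarrow> G * L"
    using q window_avg_bounded[OF t p] filterlim_ident
    by (rule convolution_tendsto)
      (rule filterlim_compose[OF lim filterlim_diff_const[OF filterlim_ident]])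
  moreover have "(\<lambda>n. (\<Sum>i<p. k (Suc (n - i))) / real p) \<longlonglongrightarrow> (\<Sum>i<p. 0) / real p"
    by (intro tendsto_divide tendsto_sum tendsto_const filterlim_compose[OF k]
        filterlim_compose[OF filterlim_Suc] filterlim_diff_const filterlim_ident) (use p in simp)
  ultimately have "(\<lambda>n. (\<Sum>i<p. k (Suc (n - i))) / real p
      + (\<Sum>j\<le>n. q j * window_avg p t (n - j))) \<longlonglongrightarrow> (\<Sum>i<p. 0) / real p + G * L"
    by (rule tendsto_add[rotated])
  moreover have "\<forall>\<^sub>F n in sequentially. (\<Sum>i<p. k (Suc (n - i))) / real p
      + (\<Sum>j\<le>n. q j * window_avg p t (n - j)) = window_avg p s (Suc n)"
    using eventually_ge_at_top[of p]
  proof eventually_elim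
    case (elim n)
    then show ?case
      by (simp add: window_avg_Suc window_avg_convolution s sum.distrib add_divide_distrib)
  qed
  ultimately have "(\<lambda>n. window_avg p s (Suc n)) \<longlonglongrightarrow> (\<Sum>i<p. 0) / real p + G * L"
    by (rule Lim_transform_eventually)
  then show ?thesis by (simp add: LIMSEQ_imp_Suc)
qed

text \<open>Here \<open>f i\<close> is the weight of the recurrence time \<open>i + 1\<close>, which
  explains the factor \<open>Suc i\<close> in the mean \<open>m\<close>; \<open>a n\<close> is the
  weight of a renewal at time \<open>n\<close>.\<close>

locale renewal =
  fixes f a :: "nat \<Rightarrow> real" and m :: real and p :: nat
  assumes f_nonneg: "f i \<ge> 0"
    and f_sums: "f sums 1"
    and mean: "(\<lambda>i. real (Suc i) * f i) sums m"
    and a_0: "a 0 = 1"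
    and a_Suc: "a (Suc n) = (\<Sum>i\<le>n. f i * a (n - i))"
    and period: "Gcd {k. 1 \<le> k \<and> a k > 0} = p"
    and p_pos: "p > 0"
begin

section \<open>Bounds, positivity and tails of a renewal sequence\<close>

lemma a_bounds: "0 \<le> a n \<and> a n \<le> 1"
proof (induction n rule: less_induct)
  case (less n)
  show ?case
  proof (cases n)
    case 0 then show ?thesis by (simp add: a_0)
  next
    case (Suc k)
    have "(\<Sum>i\<le>k. f i * a (k - i)) \<le> (\<Sum>i\<le>k. f i * 1)"
      using less.IH f_nonneg Suc by (intro sum_mono mult_left_mono) auto
    also have "\<dots> \<le> 1"
      using sum_le_suminf[of f "{..k}"] f_sums f_nonneg by (auto simp: sums_iff)
    finally have "a n \<le> 1" by (simp add: Suc a_Suc)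
    moreover have "0 \<le> a n" unfolding Suc a_Suc
      using less.IH f_nonneg Suc by (intro sum_nonneg mult_nonneg_nonneg) auto
    ultimately show ?thesis by simp
  qed
qed

text \<open>A renewal at time \<open>k\<close> followed by one \<open>l\<close> steps later is a
  renewal at \<open>k + l\<close>. Consequently the times with \<open>a\<close> positive are closed
  under addition.\<close>

lemma a_supermult: "a k * a l \<le> a (k + l)"
proof (induction k rule: less_induct)
  case (less k)
  show ?case
  proof (cases k)
    case 0 then show ?thesis by (simp add: a_0)
  next
    case (Suc n)
    have "a k * a l = (\<Sum>i\<le>n. f i * (a (n - i) * a l))"
      by (simp add: Suc a_Suc sum_distrib_right mult.assoc)
    also have "\<dots> \<le> (\<Sum>i\<le>n. f i * a (n - i + l))"
    proof (intro sum_mono mult_left_mono f_nonneg)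
      fix i show "a (n - i) * a l \<le> a (n - i + l)" using Suc by (intro less.IH) simp
    qed
    also have "\<dots> = (\<Sum>i\<le>n. f i * a (n + l - i))"
      by (intro sum.cong) auto
    also have "\<dots> \<le> (\<Sum>i\<le>n + l. f i * a (n + l - i))"
      using f_nonneg a_bounds by (intro sum_mono2) auto
    finally show ?thesis by (simp add: Suc a_Suc)
  qed
qed

lemma a_nonmultiple:
  assumes "\<not> p dvd n"
  shows "a n = 0"
proof (rule ccontr)
  assume "a n \<noteq> 0"
  moreover have "n \<noteq> 0" using assms by (rule contrapos_nn) simp
  ultimately have "n \<in> {k. 1 \<le> k \<and> a k > 0}" using a_bounds[of n] by auto
  then have "Gcd {k. 1 \<le> k \<and> a k > 0} dvd n" by (rule Gcd_dvd)
  then show False using assms period by simp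
qed

lemma a_eventually_pos:
  obtains N where "\<And>n. n \<ge> N \<Longrightarrow> p dvd n \<Longrightarrow> a n > 0"
proof -
  have "k + l \<in> {k. 1 \<le> k \<and> a k > 0}"
    if "k \<in> {k. 1 \<le> k \<and> a k > 0}" "l \<in> {k. 1 \<le> k \<and> a k > 0}" for k l
    using that less_le_trans[OF mult_pos_pos a_supermult, of k l] by simp
  then obtain N where "\<And>n. n \<ge> N \<Longrightarrow> p dvd n \<Longrightarrow> n \<in> {k. 1 \<le> k \<and> a k > 0}"
    by (rule add_closed_eventually_multiples[OF _ _ period p_pos]) auto
  then have "a n > 0" if "n \<ge> N" "p dvd n" for n using that by blast
  then show ?thesis by (rule that)
qed

text \<open>The probability that a recurrence time exceeds \<open>j\<close>.\<close>

definition tail :: "nat \<Rightarrow> real" where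
  "tail j = (\<Sum>i. f (i + j))"

lemma f_summable: "summable f"
  using f_sums by (simp add: sums_iff)

lemma tail_Suc: "tail (Suc j) = tail j - f j"
  unfolding tail_def
  using suminf_split_head[of "\<lambda>i. f (i + j)"] f_summable
  by (simp add: summable_ignore_initial_segment)

lemma tail_0: "tail 0 = 1"
  using f_sums by (simp add: tail_def sums_iff)

lemma tail_nonneg: "tail j \<ge> 0"
  unfolding tail_def using f_nonneg f_summable
  by (intro suminf_nonneg) (auto simp: summable_ignore_initial_segment)

text \<open>Up to time \<open>n\<close> there is exactly one last renewal, at some time
  \<open>n - j\<close>, and it is followed by a recurrence time exceeding \<open>j\<close>.\<close>

lemma tail_convolution: "(\<Sum>j\<le>n. tail j * a (n - j)) = 1"
proof (induction n)
  case 0 show ?case by (simp add: tail_0 a_0)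
next
  case (Suc n)
  have "(\<Sum>j\<le>Suc n. tail j * a (Suc n - j)) = a (Suc n) + (\<Sum>j\<le>n. tail (Suc j) * a (n - j))"
    by (subst sum.atMost_Suc_shift) (simp add: tail_0)
  also have "\<dots> = (\<Sum>j\<le>n. tail j * a (n - j))"
    by (simp add: tail_Suc a_Suc left_diff_distrib sum_subtractf)
  finally show ?case using Suc.IH by simp
qed

lemma sum_tail: "(\<Sum>j<n. tail j) = (\<Sum>i<n. real (Suc i) * f i) + real n * tail n"
  by (induction n) (simp_all add: tail_Suc algebra_simps)

text \<open>The expectation as the sum of the tail probabilities, obtained by summation by
  parts.\<close>

lemma tail_sums: "tail sums m"
proof -
  have sm: "summable (\<lambda>i. real (Suc i) * f i)" using mean by (simp add: sums_iff)
  \<comment> \<open>The boundary term is at most the remainder of the convergent series for the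
    mean.\<close>
  have "(\<lambda>n. real n * tail n) \<longlonglongrightarrow> 0"
  proof (rule tendsto_sandwich[OF _ _ tendsto_const])
    show "\<forall>\<^sub>F n in sequentially. 0 \<le> real n * tail n" by (simp add: tail_nonneg)
    show "\<forall>\<^sub>F n in sequentially. real n * tail n \<le> (\<Sum>i. real (Suc (i + n)) * f (i + n))"
    proof (intro always_eventually allI)
      fix n
      have "real n * tail n = (\<Sum>i. real n * f (i + n))"
        unfolding tail_def using f_summable
        by (simp add: suminf_mult summable_ignore_initial_segment)
      also have "\<dots> \<le> (\<Sum>i. real (Suc (i + n)) * f (i + n))"
        using f_nonneg sm f_summable
        by (intro suminf_le mult_right_mono)
          (auto intro!: summable_mult summable_ignore_initial_segment
            summable_ignore_initial_segment[of "\<lambda>i. real (Suc i) * f i", simplified])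
      finally show "real n * tail n \<le> (\<Sum>i. real (Suc (i + n)) * f (i + n))" .
    qed
    show "(\<lambda>n. \<Sum>i. real (Suc (i + n)) * f (i + n)) \<longlonglongrightarrow> 0"
      using suminf_exist_split2[OF sm] .
  qed
  then have "(\<lambda>n. (\<Sum>i<n. real (Suc i) * f i) + real n * tail n) \<longlonglongrightarrow> m + 0"
    using mean unfolding sums_def by (rule tendsto_add[rotated])
  then show ?thesis unfolding sums_def sum_tail by simp
qed

text \<open>The window contains exactly one multiple of \<open>p\<close>, the largest one up to
  \<open>n\<close>, and \<open>a\<close> vanishes off the multiples. The averages are thus constant
  on blocks of length \<open>p\<close>.\<close>

lemma window_avg_block: "window_avg p a n = a (p * (n div p)) / real p"
proof -
  have "(\<Sum>i<p. if i \<le> n then a (n - i) else 0) = (\<Sum>i<p. if i = n mod p then a (p * (n div p)) else 0)"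
  proof (rule sum.cong[OF refl])
    fix i assume i: "i \<in> {..<p}"
    have "a (n - i) = 0" if "i \<le> n" "i \<noteq> n mod p"
    proof (rule a_nonmultiple)
      show "\<not> p dvd n - i"
      proof
        assume "p dvd n - i"
        then have "n mod p = i mod p" using that(1) by (metis mod_eq_dvd_iff_nat)
        then show False using that(2) i by simp
      qed
    qed
    moreover have "n - n mod p = p * (n div p)" by (simp add: minus_mod_eq_mult_div)
    ultimately show "(if i \<le> n then a (n - i) else 0) = (if i = n mod p then a (p * (n div p)) else 0)"
      by auto
  qed
  also have "\<dots> = a (p * (n div p))" using p_pos by simp
  finally show ?thesis by (simp add: window_avg_def)
qed

text \<open>
  Feller's argument. Along a subsequence realising the limit superior \<open>l\<close> of \<open>g\<close>, the renewal
  equation writes \<open>g\<close> as an average of its earlier values, none of which exceeds \<open>l\<close> by much; hence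
  every shift of the subsequence by a possible return time also converges to \<open>l\<close>, and these shifts
  reach all large times. The tail identity then determines \<open>l\<close>. With \<open>c = -1\<close> the same
  argument identifies the limit inferior.
\<close>

lemma window_avg_limsup:
  fixes c :: real
  defines "g \<equiv> \<lambda>n. c * window_avg p a n"
  obtains l where "m * l = c" "\<And>e. e > 0 \<Longrightarrow> \<forall>\<^sub>F n in sequentially. g n < l + e"
proof -
  have g_bound: "\<bar>g n\<bar> \<le> \<bar>c\<bar>" for n
    using window_avg_bounded[of a 1 p n] a_bounds p_pos
    by (auto simp: g_def abs_mult intro!: mult_left_le)
  have g_Suc: "g (Suc n) = (\<Sum>i\<le>n. f i * g (n - i))" if "Suc n \<ge> p" for n
  proof -
    have "(\<Sum>i\<le>n. f i * g (n - i)) = c * (\<Sum>i\<le>n. f i * window_avg p a (n - i))"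
      by (simp add: g_def sum_distrib_left mult_ac)
    then show ?thesis
      unfolding window_avg_convolution[OF that] a_Suc[symmetric] g_def window_avg_Suc[OF that] by simp
  qed
  have g_tail: "(\<Sum>j\<le>n. tail j * g (n - j)) = c" if "Suc n \<ge> p" for n
  proof -
    have "(\<Sum>j\<le>n. tail j * g (n - j)) = c * (\<Sum>j\<le>n. tail j * window_avg p a (n - j))"
      by (simp add: g_def sum_distrib_left mult_ac)
    also have "\<dots> = c" unfolding window_avg_convolution[OF that] tail_convolution using p_pos by simp
    finally show ?thesis .
  qed
  have g_block: "g n = g n'" if "n div p = n' div p" for n n'
    using that by (simp add: g_def window_avg_block)
  obtain l r where r: "strict_mono r" and gr: "(\<lambda>k. g (r k)) \<longlonglongrightarrow> l"
    and upper: "\<And>e. e > 0 \<Longrightarrow> \<forall>\<^sub>F n in sequentially. g n < l + e"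
    using bounded_limsup_subseq[of g, OF g_bound] by blast
  \<comment> \<open>The last index of the block containing \<open>r k\<close>. It has the same value
    of \<open>g\<close>, and lags \<open>j\<close> with equal \<open>j div p\<close> lead from it
    into the same block.\<close>
  define N where "N k = p * (r k div p) + (p - 1)" for k
  have block_div: "(p * q + i) div p = q" if "i < p" for q i
    using that by (subst div_mult_self4) auto
  have N_div: "N k div p = r k div p" for k
    unfolding N_def using p_pos by (intro block_div) simp
  have N_ge: "r k \<le> N k" for k
    unfolding N_def using p_pos mult_div_mod_eq[of p "r k"] mod_less_divisor[of p "r k"]
    by linarith
  have N_lim: "filterlim N at_top sequentially"
    using filterlim_subseq[OF r] by (rule filterlim_at_top_mono) (simp add: N_ge)
  define J where "J j \<longleftrightarrow> (\<lambda>k. g (N k - j)) \<longlonglongrightarrow> l" for j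
  have J_0: "J 0"
    using gr g_block[OF N_div] by (simp add: J_def)
  have J_step: "J (j + Suc i)" if j: "J j" and i: "f i > 0" for i j
  proof -
    define n where "n k = N k - Suc j" for k
    have n_lim: "filterlim n at_top sequentially"
      unfolding n_def by (rule filterlim_diff_const[OF N_lim])
    \<comment> \<open>Raising \<open>g\<close> to at least \<open>l\<close> gives a sequence that
      converges to \<open>l\<close>, because \<open>g\<close> eventually stays below
      \<open>l + e\<close>, and makes every defect \<open>h - g\<close> nonnegative.\<close>
    define h where "h n = max (g n) l" for n
    have h_lim: "(\<lambda>k. h (n k - i)) \<longlonglongrightarrow> l" for i
    proof (rule filterlim_compose[of h])
      show "h \<longlonglongrightarrow> l"
      proof (rule order_tendstoI)
        fix b assume "b < l"
        then show "\<forall>\<^sub>F n in sequentially. b < h n" by (simp add: h_def less_max_iff_disj)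
      next
        fix b assume "l < b"
        then show "\<forall>\<^sub>F n in sequentially. h n < b" using upper[of "b - l"] by (simp add: h_def)
      qed
      show "filterlim (\<lambda>k. n k - i) at_top sequentially" by (rule filterlim_diff_const[OF n_lim])
    qed
    have "\<bar>h n\<bar> \<le> \<bar>c\<bar> + \<bar>l\<bar>" for n using g_bound[of n] by (auto simp: h_def max_def)
    then have "(\<lambda>k. \<Sum>i\<le>n k. f i * h (n k - i)) \<longlonglongrightarrow> 1 * l"
      by (rule convolution_tendsto[OF f_nonneg f_sums _ n_lim h_lim])
    moreover have "(\<lambda>k. g (N k - j)) \<longlonglongrightarrow> l" using j by (simp add: J_def)
    ultimately have diff:
      "(\<lambda>k. (\<Sum>i\<le>n k. f i * h (n k - i)) - g (N k - j)) \<longlonglongrightarrow> 1 * l - l"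
      by (rule tendsto_diff)
    have ev: "\<forall>\<^sub>F k in sequentially. i \<le> n k \<and> p \<le> n k \<and> Suc (n k) = N k - j"
    proof -
      have "\<forall>\<^sub>F k in sequentially. i + p + Suc j \<le> N k" using N_lim by (simp add: filterlim_at_top)
      then show ?thesis by eventually_elim (auto simp: n_def)
    qed
    \<comment> \<open>The weighted defects sum to a quantity tending to 0, and each of them is at
      most their sum; so the single defect at lag \<open>i\<close> vanishes in the limit.\<close>
    have "(\<lambda>k. f i * (h (n k - i) - g (n k - i))) \<longlonglongrightarrow> 0"
    proof (rule tendsto_sandwich[OF _ _ tendsto_const])
      show "\<forall>\<^sub>F k in sequentially. 0 \<le> f i * (h (n k - i) - g (n k - i))"
        using i by (simp add: h_def)
      show "(\<lambda>k. (\<Sum>i\<le>n k. f i * h (n k - i)) - g (N k - j)) \<longlonglongrightarrow> 0" using diff by simp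
      show "\<forall>\<^sub>F k in sequentially. f i * (h (n k - i) - g (n k - i))
          \<le> (\<Sum>i\<le>n k. f i * h (n k - i)) - g (N k - j)"
        using ev
      proof eventually_elim
        case (elim k)
        have "f i * (h (n k - i) - g (n k - i)) \<le> (\<Sum>i\<le>n k. f i * (h (n k - i) - g (n k - i)))"
          using elim f_nonneg
          by (intro member_le_sum[where f = "\<lambda>i. f i * (h (n k - i) - g (n k - i))"])
            (auto simp: h_def)
        also have "\<dots> = (\<Sum>i\<le>n k. f i * h (n k - i)) - g (Suc (n k))"
          using elim g_Suc[of "n k"] by (simp add: right_diff_distrib sum_subtractf)
        finally show ?case using elim by simp
      qed
    qed
    then have "(\<lambda>k. f i * (h (n k - i) - g (n k - i)) / f i) \<longlonglongrightarrow> 0 / f i"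
      by (intro tendsto_divide tendsto_const) (use i in auto)
    then have "(\<lambda>k. h (n k - i) - g (n k - i)) \<longlonglongrightarrow> 0" using i by simp
    then have "(\<lambda>k. h (n k - i) - (h (n k - i) - g (n k - i))) \<longlonglongrightarrow> l - 0"
      by (rule tendsto_diff[OF h_lim])
    then show ?thesis by (simp add: J_def n_def add.commute)
  qed
  \<comment> \<open>A positive \<open>a d\<close> arises from a chain of recurrence times of
    positive weight; strong induction splits off one of them.\<close>
  have J_pos: "J d" if "a d > 0" for d
    using that
  proof (induction d rule: less_induct)
    case (less d)
    show ?case
    proof (cases d)
      case 0 then show ?thesis using J_0 by simp
    next
      case (Suc n)
      have "(\<Sum>i\<le>n. f i * a (n - i)) \<noteq> 0" using less.prems by (simp add: Suc a_Suc)
      then obtain i where i: "i \<le> n" "f i * a (n - i) \<noteq> 0"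
        by (meson atMost_iff sum.neutral)
      then have "f i > 0" "a (n - i) > 0" using f_nonneg[of i] a_bounds[of "n - i"] by auto
      then have "J (n - i + Suc i)" using less.IH Suc by (intro J_step) auto
      then show ?thesis using i Suc by simp
    qed
  qed
  obtain N0 where N0: "\<And>n. n \<ge> N0 \<Longrightarrow> p dvd n \<Longrightarrow> a n > 0" using a_eventually_pos by blast
  have J_large: "J j" if "j \<ge> N0 + p" for j
  proof -
    \<comment> \<open>The largest multiple of \<open>p\<close> up to \<open>j\<close>; the lags
      \<open>t\<close> and \<open>j\<close> lead from \<open>N k\<close> into the same block, so the
      claim passes from \<open>t\<close> to \<open>j\<close>.\<close>
    define t where "t = p * (j div p)"
    have jt: "j = t + j mod p" "j mod p < p" using p_pos by (auto simp: t_def)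
    then have "t \<ge> N0" using that by linarith
    then have "J t" by (intro J_pos N0) (simp_all add: t_def)
    moreover have "\<forall>\<^sub>F k in sequentially. g (N k - t) = g (N k - j)"
    proof -
      have "\<forall>\<^sub>F k in sequentially. p * (j div p) + p \<le> N k" using N_lim by (simp add: filterlim_at_top)
      then show ?thesis
      proof eventually_elim
        case (elim k)
        have "(p * (j div p) + p) div p \<le> N k div p" using elim by (rule div_le_mono)
        then obtain q where q: "r k div p = j div p + q"
          using p_pos by (auto simp: N_div le_iff_add)
        have "N k - t = p * q + (p - 1)"
          by (simp add: N_def t_def q algebra_simps)
        moreover have "N k - j = p * q + (p - 1 - j mod p)"
          using calculation jt by linarith
        moreover have "(p * q + (p - 1)) div p = q" "(p * q + (p - 1 - j mod p)) div p = q"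
          using p_pos by (intro block_div; simp)+
        ultimately show ?case by (intro g_block) (simp only:)
      qed
    qed
    ultimately show ?thesis unfolding J_def by (rule Lim_transform_eventually)
  qed
  \<comment> \<open>Moving back by \<open>N0 + p\<close> makes all further lags admissible, so the
    tail identity can be passed to the limit term by term.\<close>
  define n where "n k = N k - (N0 + p)" for k
  have n_lim: "filterlim n at_top sequentially"
    unfolding n_def by (rule filterlim_diff_const[OF N_lim])
  have "(\<lambda>k. g (n k - i)) \<longlonglongrightarrow> l" for i
    using J_large[of "N0 + p + i"] by (simp add: J_def n_def)
  then have "(\<lambda>k. \<Sum>j\<le>n k. tail j * g (n k - j)) \<longlonglongrightarrow> m * l"
    by (rule convolution_tendsto[OF tail_nonneg tail_sums g_bound n_lim])
  moreover
  have "\<forall>\<^sub>F k in sequentially. (\<Sum>j\<le>n k. tail j * g (n k - j)) = c"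
  proof -
    have "\<forall>\<^sub>F k in sequentially. p \<le> n k" using n_lim by (simp add: filterlim_at_top)
    then show ?thesis by eventually_elim (simp add: g_tail)
  qed
  then have "(\<lambda>k. \<Sum>j\<le>n k. tail j * g (n k - j)) \<longlonglongrightarrow> c" by (rule tendsto_eventually)
  ultimately have "m * l = c" by (rule LIMSEQ_unique)
  then show ?thesis using that upper by blast
qed

theorem renewal_theorem: "window_avg p a \<longlonglongrightarrow> 1 / m"
proof -
  obtain l where l: "m * l = 1" "\<And>e. e > 0 \<Longrightarrow> \<forall>\<^sub>F n in sequentially. 1 * window_avg p a n < l + e"
    using window_avg_limsup[of 1] by blast
  obtain l' where l': "m * l' = -1" "\<And>e. e > 0 \<Longrightarrow> \<forall>\<^sub>F n in sequentially. -1 * window_avg p a n < l' + e"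
    using window_avg_limsup[of "-1"] by blast
  have m: "m \<noteq> 0" using l by auto
  have eq: "l = 1 / m" "l' = - (1 / m)" using l(1) l'(1) m by (auto simp: field_simps)
  show ?thesis
  proof (rule order_tendstoI)
    fix b assume "b < 1 / m"
    then show "\<forall>\<^sub>F n in sequentially. b < window_avg p a n" using l'(2)[of "1 / m - b"] eq by simp
  next
    fix b assume "1 / m < b"
    then show "\<forall>\<^sub>F n in sequentially. window_avg p a n < b" using l(2)[of "b - 1 / m"] eq by simp
  qed
qed

end

section \<open>Path weights of the Markov chain\<close>

lemma markov_chain_sets:
  fixes X :: "nat \<Rightarrow> 'w \<Rightarrow> 't"
  assumes "markov_chain M X K x"
  shows "{\<omega> \<in> space M. X n \<omega> = y} \<in> sets M"
proof -
  have "X n \<in> measurable M (count_space UNIV)" using assms by (simp add: markov_chain_def)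
  then have "X n -` {y} \<inter> space M \<in> sets M" by (rule measurable_sets) simp
  then show ?thesis by (simp add: vimage_def Int_def conj_commute)
qed

text \<open>The Markov property is given for single trajectories only. A past of fixed length is a
  list over a countable type, so an event of the past is a countable disjoint union of such
  trajectories and the identity sums up.\<close>

lemma markov_chain_history:
  fixes X :: "nat \<Rightarrow> 'w \<Rightarrow> 't::countable" and n :: nat
  defines "past \<equiv> \<lambda>\<omega>. map (\<lambda>i. X i \<omega>) [0..<Suc n]"
  assumes mc: "markov_chain M X K x"
  shows "{\<omega> \<in> space M. H (past \<omega>) \<and> X n \<omega> = w \<and> X (Suc n) \<omega> = y} \<in> sets M"
    and "emeasure M {\<omega> \<in> space M. H (past \<omega>) \<and> X n \<omega> = w \<and> X (Suc n) \<omega> = y}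
       = emeasure M {\<omega> \<in> space M. H (past \<omega>) \<and> X n \<omega> = w} * ennreal (K w y)"
proof -
  interpret prob_space M using mc by (simp add: markov_chain_def)
  define I where "I = {l. length l = Suc n \<and> H l \<and> l ! n = w}"
  define E where "E l = {\<omega> \<in> space M. \<forall>i\<le>n. X i \<omega> = l ! i}" for l
  define F where "F l = {\<omega> \<in> space M. (\<forall>i\<le>n. X i \<omega> = l ! i) \<and> X (Suc n) \<omega> = y}" for l
  have past: "past \<omega> = l \<longleftrightarrow> length l = Suc n \<and> (\<forall>i\<le>n. X i \<omega> = l ! i)" for \<omega> l
    by (auto simp: past_def list_eq_iff_nth_eq less_Suc_eq_le simp del: upt_Suc)
  have E_sets: "E l \<in> sets M" for l
  proof -
    have "E l = (\<Inter>i\<in>{..n}. {\<omega> \<in> space M. X i \<omega> = l ! i})" by (auto simp: E_def)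
    then show ?thesis using markov_chain_sets[OF mc] by (auto intro!: sets.finite_INT)
  qed
  have F_sets: "F l \<in> sets M" for l
  proof -
    have "F l = E l \<inter> {\<omega> \<in> space M. X (Suc n) \<omega> = y}" by (auto simp: E_def F_def)
    then show ?thesis using markov_chain_sets[OF mc] E_sets by auto
  qed
  have step: "emeasure M (F l) = emeasure M (E l) * ennreal (K w y)" if "l \<in> I" for l
  proof -
    have "prob (F l) = prob (E l) * K (l ! n) y"
      using mc unfolding markov_chain_def E_def F_def by blast
    then have "prob (F l) = prob (E l) * K w y" using that by (simp add: I_def)
    then show ?thesis by (simp add: emeasure_eq_measure ennreal_mult')
  qed
  have in_I: "past \<omega> \<in> I \<longleftrightarrow> H (past \<omega>) \<and> X n \<omega> = w" for \<omega>
    using past[of \<omega> "past \<omega>"] by (auto simp: I_def)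
  have mem: "\<omega> \<in> E l \<longleftrightarrow> \<omega> \<in> space M \<and> past \<omega> = l" if "l \<in> I" for \<omega> l
    using that by (auto simp: E_def I_def past)
  have EU: "{\<omega> \<in> space M. H (past \<omega>) \<and> X n \<omega> = w} = (\<Union>l\<in>I. E l)"
    unfolding in_I[symmetric] using mem by auto
  have "\<omega> \<in> F l \<longleftrightarrow> \<omega> \<in> E l \<and> X (Suc n) \<omega> = y" for \<omega> l
    by (auto simp: E_def F_def)
  then have "{\<omega> \<in> space M. past \<omega> \<in> I \<and> X (Suc n) \<omega> = y} = (\<Union>l\<in>I. F l)"
    using mem by auto
  then have FU: "{\<omega> \<in> space M. H (past \<omega>) \<and> X n \<omega> = w \<and> X (Suc n) \<omega> = y} = (\<Union>l\<in>I. F l)"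
    by (simp add: in_I)
  show "{\<omega> \<in> space M. H (past \<omega>) \<and> X n \<omega> = w \<and> X (Suc n) \<omega> = y} \<in> sets M"
    unfolding FU using F_sets by (intro sets.countable_UN') auto
  have disj: "disjoint_family_on E I"
  proof (unfold disjoint_family_on_def, safe)
    fix l l' \<omega> assume "l \<in> I" "l' \<in> I" "l \<noteq> l'" "\<omega> \<in> E l" "\<omega> \<in> E l'"
    then have "past \<omega> = l" "past \<omega> = l'" using mem by blast+
    then show "\<omega> \<in> {}" using \<open>l \<noteq> l'\<close> by simp
  qed
  have "disjoint_family_on F I"
    using disj by (rule disjoint_family_on_bisimulation) (auto simp: E_def F_def)
  then have "emeasure M (\<Union>l\<in>I. F l) = (\<integral>\<^sup>+ l. emeasure M (F l) \<partial>count_space I)"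
    using F_sets by (intro emeasure_UN_countable) auto
  also have "\<dots> = (\<integral>\<^sup>+ l. emeasure M (E l) * ennreal (K w y) \<partial>count_space I)"
    by (intro nn_integral_cong) (simp add: step)
  also have "\<dots> = (\<integral>\<^sup>+ l. emeasure M (E l) \<partial>count_space I) * ennreal (K w y)"
    by (intro nn_integral_multc) simp
  also have "(\<integral>\<^sup>+ l. emeasure M (E l) \<partial>count_space I) = emeasure M (\<Union>l\<in>I. E l)"
    using disj E_sets by (intro emeasure_UN_countable[symmetric]) auto
  finally show "emeasure M {\<omega> \<in> space M. H (past \<omega>) \<and> X n \<omega> = w \<and> X (Suc n) \<omega> = y}
       = emeasure M {\<omega> \<in> space M. H (past \<omega>) \<and> X n \<omega> = w} * ennreal (K w y)"
    by (simp only: FU EU)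
qed

section \<open>Return and absorption times in terms of the trajectory\<close>

lemma enat_less_INF_iff: "enat n < (INF k\<in>S. enat k) \<longleftrightarrow> (\<forall>k\<in>S. n < k)"
  by (auto simp: Suc_ile_eq[symmetric] le_INF_iff Suc_le_eq)

lemma enat_less_return_time:
  "enat n < return_time X z \<omega> \<longleftrightarrow> (\<forall>i. 1 \<le> i \<and> i \<le> n \<longrightarrow> X i \<omega> \<noteq> Some z)"
  unfolding return_time_def enat_less_INF_iff by (auto simp: not_le[symmetric])

lemma enat_less_absorption_time:
  "enat n < absorption_time X \<omega> \<longleftrightarrow> (\<forall>i\<le>n. X i \<omega> \<noteq> None)"
  unfolding absorption_time_def enat_less_INF_iff by (auto simp: not_le[symmetric])

text \<open>The event that \<open>n\<close> precedes both return and absorption. Time 0 is exempt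
  from the condition on \<open>z\<close>, since the chain may start there.\<close>

definition alive :: "(nat \<Rightarrow> 'w \<Rightarrow> 's option) \<Rightarrow> 's \<Rightarrow> nat \<Rightarrow> 'w \<Rightarrow> bool" where
  "alive X z n \<omega> \<longleftrightarrow> (\<forall>i\<le>n. X i \<omega> \<noteq> None) \<and> (\<forall>i. 1 \<le> i \<and> i \<le> n \<longrightarrow> X i \<omega> \<noteq> Some z)"

lemma return_time_eq_Suc:
  "return_time X z \<omega> = enat (Suc n) \<longleftrightarrow>
     (\<forall>i. 1 \<le> i \<and> i \<le> n \<longrightarrow> X i \<omega> \<noteq> Some z) \<and> X (Suc n) \<omega> = Some z"
proof -
  have "return_time X z \<omega> = enat (Suc n) \<longleftrightarrow>
      enat n < return_time X z \<omega> \<and> \<not> enat (Suc n) < return_time X z \<omega>"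
    by (simp only: Suc_ile_eq[symmetric, of n] not_less) auto
  then show ?thesis unfolding enat_less_return_time by (auto simp: le_Suc_eq)
qed

lemma return_before_absorption:
  "return_time X z \<omega> = enat (Suc n) \<and> return_time X z \<omega> < absorption_time X \<omega>
     \<longleftrightarrow> alive X z n \<omega> \<and> X (Suc n) \<omega> = Some z"
proof (cases "return_time X z \<omega> = enat (Suc n)")
  case True
  then show ?thesis
    using return_time_eq_Suc[of X z \<omega> n] enat_less_absorption_time[of "Suc n" X \<omega>]
    by (auto simp: alive_def le_Suc_eq)
next
  case False
  then show ?thesis unfolding return_time_eq_Suc alive_def by auto
qed

text \<open>Splits according to the value of the return time. At most one summand is nonzero, and
  the index starts at \<open>Suc 0\<close> because a return time is never 0.\<close>

lemma weight_at_return: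
  fixes g :: "nat \<Rightarrow> ennreal"
  shows "(if return_time X z \<omega> < absorption_time X \<omega> then g (the_enat (return_time X z \<omega>)) else 0)
    = (\<Sum>n. if alive X z n \<omega> \<and> X (Suc n) \<omega> = Some z then g (Suc n) else 0)"
proof (cases "return_time X z \<omega> < absorption_time X \<omega>")
  case True
  then obtain k where k: "return_time X z \<omega> = enat k" by (cases "return_time X z \<omega>") auto
  have "enat 0 < return_time X z \<omega>" by (simp only: enat_less_return_time) auto
  then obtain m where m: "return_time X z \<omega> = enat (Suc m)" using k by (cases k) auto
  have "(\<Sum>n. if alive X z n \<omega> \<and> X (Suc n) \<omega> = Some z then g (Suc n) else 0)
      = (\<Sum>n. if n = m then g (Suc n) else 0)"
    unfolding return_before_absorption[symmetric] using True m by (intro suminf_cong) auto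
  also have "\<dots> = g (Suc m)" using suminf_finite[of "{m}" "\<lambda>n. if n = m then g (Suc n) else 0"] by simp
  finally show ?thesis using True m by simp
next
  case False
  then show ?thesis unfolding return_before_absorption[symmetric] by simp
qed

section \<open>Expectations for the chain as sums of taboo powers\<close>

context
  fixes B :: "'s::countable \<Rightarrow> 's \<Rightarrow> real" and M :: "'w measure"
    and X :: "nat \<Rightarrow> 'w \<Rightarrow> 's option" and x z :: 's and \<theta> :: real
    and A :: "'s \<Rightarrow> 's \<Rightarrow> ennreal"
  assumes mc: "markov_chain M X (cemetery_ext B) (Some x)"
  defines "A \<equiv> \<lambda>x y. ennreal (exp \<theta> * B x y)"
begin

lemma alive_sets: "{\<omega> \<in> space M. alive X z n \<omega> \<and> X n \<omega> = w} \<in> sets M"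
proof -
  have "{\<omega> \<in> space M. alive X z n \<omega> \<and> X n \<omega> = w}
      = {\<omega> \<in> space M. X n \<omega> = w}
        - ((\<Union>i\<in>{..n}. {\<omega> \<in> space M. X i \<omega> = None})
           \<union> (\<Union>i\<in>{1..n}. {\<omega> \<in> space M. X i \<omega> = Some z}))"
    by (auto simp: alive_def)
  then show ?thesis using markov_chain_sets[OF mc] by auto
qed

lemma alive_step:
  "{\<omega> \<in> space M. alive X z n \<omega> \<and> X (Suc n) \<omega> = Some y} \<in> sets M"
  "emeasure M {\<omega> \<in> space M. alive X z n \<omega> \<and> X (Suc n) \<omega> = Some y}
   = (\<integral>\<^sup>+ w. emeasure M {\<omega> \<in> space M. alive X z n \<omega> \<and> X n \<omega> = Some w} * ennreal (B w y)
        \<partial>count_space UNIV)"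
proof -
  define H where "H l \<longleftrightarrow> (\<forall>i\<le>n. l ! i \<noteq> None) \<and> (\<forall>i. 1 \<le> i \<and> i \<le> n \<longrightarrow> l ! i \<noteq> Some z)" for l
  have nth: "map (\<lambda>i. X i \<omega>) [0..<Suc n] ! i = X i \<omega>" if "i \<le> n" for i \<omega>
    using that by (simp del: upt_Suc)
  have H: "H (map (\<lambda>i. X i \<omega>) [0..<Suc n]) \<longleftrightarrow> alive X z n \<omega>" for \<omega>
    by (simp add: H_def alive_def nth del: upt_Suc)
  let ?G = "\<lambda>w. {\<omega> \<in> space M. alive X z n \<omega> \<and> X n \<omega> = Some w \<and> X (Suc n) \<omega> = Some y}"
  have U: "{\<omega> \<in> space M. alive X z n \<omega> \<and> X (Suc n) \<omega> = Some y} = (\<Union>w. ?G w)"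
    by (auto simp: alive_def)
  have G_sets: "?G w \<in> sets M" for w
    using markov_chain_history(1)[OF mc, where H = H and n = n and w = "Some w" and y = "Some y"]
    by (simp only: H)
  show "{\<omega> \<in> space M. alive X z n \<omega> \<and> X (Suc n) \<omega> = Some y} \<in> sets M"
    unfolding U using G_sets by (intro sets.countable_UN') auto
  have "emeasure M (\<Union>w. ?G w) = (\<integral>\<^sup>+ w. emeasure M (?G w) \<partial>count_space UNIV)"
    using G_sets by (intro emeasure_UN_countable) (auto simp: disjoint_family_on_def)
  also have "\<dots> = (\<integral>\<^sup>+ w. emeasure M {\<omega> \<in> space M. alive X z n \<omega> \<and> X n \<omega> = Some w}
      * ennreal (B w y) \<partial>count_space UNIV)"
  proof (intro nn_integral_cong)
    fix w
    show "emeasure M (?G w) = emeasure M {\<omega> \<in> space M. alive X z n \<omega> \<and> X n \<omega> = Some w}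
        * ennreal (B w y)"
      using markov_chain_history(2)[OF mc, where H = H and n = n and w = "Some w" and y = "Some y"]
      by (simp only: H cemetery_ext.simps)
  qed
  finally show "emeasure M {\<omega> \<in> space M. alive X z n \<omega> \<and> X (Suc n) \<omega> = Some y}
   = (\<integral>\<^sup>+ w. emeasure M {\<omega> \<in> space M. alive X z n \<omega> \<and> X n \<omega> = Some w} * ennreal (B w y)
        \<partial>count_space UNIV)"
    by (simp only: U)
qed

lemma alive_scaled_step:
  "ennreal (exp (\<theta> * real (Suc n))) *
     emeasure M {\<omega> \<in> space M. alive X z n \<omega> \<and> X (Suc n) \<omega> = Some y}
   = (\<integral>\<^sup>+ w. (ennreal (exp (\<theta> * real n)) *
        emeasure M {\<omega> \<in> space M. alive X z n \<omega> \<and> X n \<omega> = Some w}) * A w y \<partial>count_space UNIV)"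
proof -
  have "ennreal (exp (\<theta> * real (Suc n))) = ennreal (exp (\<theta> * real n)) * ennreal (exp \<theta>)"
    by (simp add: algebra_simps exp_add flip: ennreal_mult)
  moreover have "A w y = ennreal (exp \<theta>) * ennreal (B w y)" for w
    by (simp add: A_def ennreal_mult')
  ultimately show ?thesis
    unfolding alive_step(2) by (simp add: mult_ac flip: nn_integral_cmult)
qed

text \<open>Both sides obey the same recursion in the last step, each step contributing one factor
  \<open>exp \<theta>\<close> that is absorbed into \<open>A\<close>. At \<open>y = z\<close> both
  vanish after time 0.\<close>

lemma alive_weight:
  "ennreal (exp (\<theta> * real n)) * emeasure M {\<omega> \<in> space M. alive X z n \<omega> \<and> X n \<omega> = Some y}
   = (taboo_act A z ^^ n) (point y) x"
proof (induction n arbitrary: y)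
  case 0
  interpret prob_space M using mc by (simp add: markov_chain_def)
  have ae: "AE \<omega> in M. X 0 \<omega> = Some x" using mc by (simp add: markov_chain_def)
  have "{\<omega> \<in> space M. alive X z 0 \<omega> \<and> X 0 \<omega> = Some y} = {\<omega> \<in> space M. X 0 \<omega> = Some y}"
    by (auto simp: alive_def)
  moreover have "emeasure M {\<omega> \<in> space M. X 0 \<omega> = Some y} = (if x = y then 1 else 0)"
  proof (cases "x = y")
    case True
    then show ?thesis using ae emeasure_eq_1_AE[OF markov_chain_sets[OF mc, of 0 "Some y"]] by simp
  next
    case False
    have "AE \<omega> in M. \<omega> \<notin> {\<omega> \<in> space M. X 0 \<omega> = Some y}" using ae by (rule AE_mp) (use False in auto)
    then have "emeasure M {\<omega> \<in> space M. X 0 \<omega> = Some y} = emeasure M {}"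
      by (intro emeasure_eq_AE markov_chain_sets[OF mc]) auto
    then show ?thesis using False by simp
  qed
  ultimately show ?case by (simp add: point_def)
next
  case (Suc n)
  show ?case
  proof (cases "y = z")
    case True
    then have "{\<omega> \<in> space M. alive X z (Suc n) \<omega> \<and> X (Suc n) \<omega> = Some y} = {}"
      by (auto simp: alive_def)
    then show ?thesis using True by (simp only: taboo_pow_point_Suc) simp
  next
    case False
    then have "{\<omega> \<in> space M. alive X z (Suc n) \<omega> \<and> X (Suc n) \<omega> = Some y}
        = {\<omega> \<in> space M. alive X z n \<omega> \<and> X (Suc n) \<omega> = Some y}"
      by (auto simp: alive_def le_Suc_eq)
    then show ?thesis using False by (simp only: taboo_pow_point_Suc alive_scaled_step Suc.IH) simp
  qed
qed

lemma return_weight: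
  "ennreal (exp (\<theta> * real (Suc n))) *
     emeasure M {\<omega> \<in> space M. alive X z n \<omega> \<and> X (Suc n) \<omega> = Some z} = first_hit A z n x"
  unfolding alive_scaled_step alive_weight taboo_pow_dual first_hit_def ..

lemma nn_integral_at_return:
  "(\<integral>\<^sup>+ \<omega>. (if return_time X z \<omega> < absorption_time X \<omega>
      then g (the_enat (return_time X z \<omega>)) else 0) \<partial>M)
   = (\<Sum>n. g (Suc n) * emeasure M {\<omega> \<in> space M. alive X z n \<omega> \<and> X (Suc n) \<omega> = Some z})"
proof -
  have "(\<integral>\<^sup>+ \<omega>. (if return_time X z \<omega> < absorption_time X \<omega>
      then g (the_enat (return_time X z \<omega>)) else 0) \<partial>M)
      = (\<integral>\<^sup>+ \<omega>. (\<Sum>n. g (Suc n) *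
          indicator {\<omega> \<in> space M. alive X z n \<omega> \<and> X (Suc n) \<omega> = Some z} \<omega>) \<partial>M)"
    unfolding weight_at_return by (intro nn_integral_cong suminf_cong) auto
  also have "\<dots> = (\<Sum>n. \<integral>\<^sup>+ \<omega>. g (Suc n) *
          indicator {\<omega> \<in> space M. alive X z n \<omega> \<and> X (Suc n) \<omega> = Some z} \<omega> \<partial>M)"
    using alive_step(1) by (intro nn_integral_suminf) auto
  also have "\<dots> = (\<Sum>n. g (Suc n) *
      emeasure M {\<omega> \<in> space M. alive X z n \<omega> \<and> X (Suc n) \<omega> = Some z})"
    using alive_step(1) by (simp add: nn_integral_cmult_indicator)
  finally show ?thesis .
qed

lemma nn_integral_exp_return: "(\<integral>\<^sup>+ \<omega>. exp_return \<theta> X z \<omega> \<partial>M) = hit_total A z x"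
  unfolding exp_return_def hit_total_def return_weight[symmetric]
  by (rule nn_integral_at_return)

lemma nn_integral_time_exp_return:
  "(\<integral>\<^sup>+ \<omega>. time_exp_return \<theta> X z \<omega> \<partial>M) = (\<Sum>n. of_nat (Suc n) * first_hit A z n x)"
proof -
  have "(\<integral>\<^sup>+ \<omega>. time_exp_return \<theta> X z \<omega> \<partial>M)
      = (\<Sum>n. ennreal (real (Suc n) * exp (\<theta> * real (Suc n))) *
          emeasure M {\<omega> \<in> space M. alive X z n \<omega> \<and> X (Suc n) \<omega> = Some z})"
    unfolding time_exp_return_def by (rule nn_integral_at_return)
  also have "\<dots> = (\<Sum>n. of_nat (Suc n) * first_hit A z n x)"
    unfolding return_weight[symmetric]
    by (simp only: ennreal_mult' of_nat_0_le_iff ennreal_of_nat_eq_real_of_nat mult.assoc)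
  finally show ?thesis .
qed

lemma nn_integral_visits:
  "(\<integral>\<^sup>+ \<omega>. (\<Sum>j. if enat j < return_time X z \<omega> \<and> X j \<omega> = Some y \<and> enat j < absorption_time X \<omega>
      then ennreal (exp (\<theta> * real j)) else 0) \<partial>M)
   = (\<Sum>j. (taboo_act A z ^^ j) (point y) x)"
proof -
  have "(\<integral>\<^sup>+ \<omega>. (\<Sum>j. if enat j < return_time X z \<omega> \<and> X j \<omega> = Some y \<and> enat j < absorption_time X \<omega>
      then ennreal (exp (\<theta> * real j)) else 0) \<partial>M)
      = (\<integral>\<^sup>+ \<omega>. (\<Sum>j. ennreal (exp (\<theta> * real j)) *
          indicator {\<omega> \<in> space M. alive X z j \<omega> \<and> X j \<omega> = Some y} \<omega>) \<partial>M)"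
    by (intro nn_integral_cong suminf_cong)
      (auto simp: enat_less_return_time enat_less_absorption_time alive_def indicator_def)
  also have "\<dots> = (\<Sum>j. \<integral>\<^sup>+ \<omega>. ennreal (exp (\<theta> * real j)) *
          indicator {\<omega> \<in> space M. alive X z j \<omega> \<and> X j \<omega> = Some y} \<omega> \<partial>M)"
    using alive_sets by (intro nn_integral_suminf) auto
  also have "\<dots> = (\<Sum>j. (taboo_act A z ^^ j) (point y) x)"
    using alive_sets by (simp add: nn_integral_cmult_indicator alive_weight)
  finally show ?thesis .
qed

end

section \<open>Ratio limits and eigenvectors\<close>

lemma nn_integral_count_space_has_sum:
  fixes f :: "'a \<Rightarrow> real"
  assumes "\<And>x. f x \<ge> 0" and "(f has_sum s) UNIV"
  shows "(\<integral>\<^sup>+ x. ennreal (f x) \<partial>count_space UNIV) = ennreal s"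
proof -
  have sm: "Infinite_Set_Sum.abs_summable_on f UNIV"
    by (rule iffD1[OF abs_summable_equivalent iffD1[OF summable_on_iff_abs_summable_on_real
          has_sum_imp_summable[OF assms(2)]]])
  then have "(\<integral>\<^sup>+ x. ennreal (f x) \<partial>count_space UNIV) = ennreal (infsetsum f UNIV)"
    using assms(1) by (intro nn_integral_conv_infsetsum)
  also have "infsetsum f UNIV = s"
    using infsetsum_infsum[OF sm] infsumI[OF assms(2)] by simp
  finally show ?thesis .
qed

lemma summable_on_if_nn_integral_finite:
  fixes f :: "'a \<Rightarrow> real"
  assumes "\<And>x. f x \<ge> 0" and "(\<integral>\<^sup>+ x. ennreal (f x) \<partial>count_space UNIV) < \<infinity>"
  shows "f summable_on UNIV"
proof -
  have "integrable (count_space UNIV) f"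
    using assms by (intro integrableI_nonneg) auto
  then have "Infinite_Set_Sum.abs_summable_on f UNIV"
    by (simp add: Infinite_Set_Sum.abs_summable_on_def)
  then show ?thesis
    by (rule iffD2[OF summable_on_iff_abs_summable_on_real iffD2[OF abs_summable_equivalent]])
qed

lemma mat_pow_bounds:
  assumes "substochastic B"
  shows "0 \<le> mat_pow B n x y \<and> mat_pow B n x y \<le> 1"
proof (induction n arbitrary: x)
  case (Suc n)
  have B: "B x w \<ge> 0" "(\<lambda>w. B x w) summable_on UNIV" "(\<Sum>\<^sub>\<infinity>w. B x w) \<le> 1" for w
    using assms by (auto simp: substochastic_def)
  have le: "B x w * mat_pow B n w y \<le> B x w" for w
    using Suc.IH[of w] B(1) by (simp add: mult_left_le)
  have nn: "0 \<le> B x w * mat_pow B n w y" for w using Suc.IH[of w] B(1) by simp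
  have "(\<Sum>\<^sub>\<infinity>w. B x w * mat_pow B n w y) \<le> (\<Sum>\<^sub>\<infinity>w. B x w)"
    using summable_on_comparison_test[OF B(2) le nn] B(2) le by (intro infsum_mono)
  then show ?case using B(3) nn by (auto intro!: infsum_nonneg)
qed simp

text \<open>Domination by the row of \<open>B\<close> gives summability, so the recursion for
  \<open>mat_pow\<close> never falls back on the default value 0 of \<open>infsum\<close>.\<close>

lemma mat_pow_has_sum:
  assumes "substochastic B"
  shows "((\<lambda>w. B x w * mat_pow B n w y) has_sum mat_pow B (Suc n) x y) UNIV"
proof -
  have B: "B x w \<ge> 0" "(\<lambda>w. B x w) summable_on UNIV" for w
    using assms by (auto simp: substochastic_def)
  have "B x w * mat_pow B n w y \<le> B x w" "0 \<le> B x w * mat_pow B n w y" for w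
    using mat_pow_bounds[OF assms, of n w y] B(1) by (auto simp: mult_left_le)
  then have "(\<lambda>w. B x w * mat_pow B n w y) summable_on UNIV"
    by (intro summable_on_comparison_test[OF B(2)])
  then show ?thesis by (simp add: has_sum_infsum)
qed

lemma act_scaled_has_sum:
  fixes \<theta> :: real
  assumes "\<And>w. B x w \<ge> 0" and "\<And>w. h w \<ge> 0" and "((\<lambda>w. B x w * h w) has_sum s) UNIV"
  shows "act (\<lambda>x y. ennreal (exp \<theta> * B x y)) (\<lambda>w. ennreal (h w)) x = ennreal (exp \<theta> * s)"
proof -
  have "act (\<lambda>x y. ennreal (exp \<theta> * B x y)) (\<lambda>w. ennreal (h w)) x
      = (\<integral>\<^sup>+ w. ennreal (exp \<theta> * (B x w * h w)) \<partial>count_space UNIV)"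
    unfolding act_def using assms by (intro nn_integral_cong) (simp add: mult.assoc flip: ennreal_mult)
  also have "\<dots> = ennreal (exp \<theta> * s)"
    using assms by (intro nn_integral_count_space_has_sum has_sum_cmult_right) auto
  finally show ?thesis .
qed

lemma act_pow_mat_pow:
  assumes "substochastic B"
  shows "(act (\<lambda>x y. ennreal (exp \<theta> * B x y)) ^^ n) (point y) x
       = ennreal (exp (\<theta> * real n) * mat_pow B n x y)"
proof (induction n arbitrary: x)
  case (Suc n)
  let ?A = "\<lambda>x y. ennreal (exp \<theta> * B x y)"
  have "(act ?A ^^ Suc n) (point y) x
      = act ?A (\<lambda>w. ennreal (exp (\<theta> * real n) * mat_pow B n w y)) x"
    by (simp add: Suc.IH[abs_def])
  also have "\<dots> = ennreal (exp \<theta> * (exp (\<theta> * real n) * mat_pow B (Suc n) x y))"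
  proof (rule act_scaled_has_sum)
    show "((\<lambda>w. B x w * (exp (\<theta> * real n) * mat_pow B n w y))
        has_sum exp (\<theta> * real n) * mat_pow B (Suc n) x y) UNIV"
      using has_sum_cmult_right[OF mat_pow_has_sum[OF assms, of x n y], of "exp (\<theta> * real n)"]
      by (simp only: mult.left_commute)
  qed (use assms mat_pow_bounds[OF assms] in \<open>auto simp: substochastic_def\<close>)
  also have "exp \<theta> * (exp (\<theta> * real n) * mat_pow B (Suc n) x y)
      = exp (\<theta> * real (Suc n)) * mat_pow B (Suc n) x y"
    by (simp add: algebra_simps exp_add)
  finally show ?case .
qed (simp add: point_def)

lemma act_pow_point_trans:
  assumes "(act A ^^ m) (point y) x > 0" and "(act A ^^ n) (point w) y > 0"
  shows "(act A ^^ (m + n)) (point w) x > 0"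
proof -
  let ?h = "(act A ^^ n) (point w)"
  have "?h y * (act A ^^ m) (point y) x = (act A ^^ m) (\<lambda>v. ?h y * point y v) x"
    by (simp add: act_pow_cmult)
  also have "\<dots> \<le> (act A ^^ m) ?h x" by (intro act_pow_mono point_le)
  finally have "?h y * (act A ^^ m) (point y) x \<le> (act A ^^ (m + n)) (point w) x"
    by (simp add: funpow_add)
  then show ?thesis using assms by (meson ennreal_zero_less_mult_iff less_le_trans)
qed

text \<open>Take a path from \<open>x\<close> to \<open>y\<close> and one back. Closed paths at
  \<open>x\<close> exist with and without a loop of length \<open>k\<close> inserted at
  \<open>y\<close>, so the gcd at \<open>x\<close> divides \<open>k\<close>.\<close>

lemma period_independent:
  assumes "irreducible_act A"
  shows "Gcd {k. 1 \<le> k \<and> (act A ^^ k) (point x) x > 0}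
       = Gcd {k. 1 \<le> k \<and> (act A ^^ k) (point y) y > 0}"
proof -
  define S where "S x = {k. 1 \<le> k \<and> (act A ^^ k) (point x) x > 0}" for x
  have "Gcd (S x) dvd Gcd (S y)" for x y
  proof (rule Gcd_greatest)
    fix k assume "k \<in> S y"
    then have k: "(act A ^^ k) (point y) y > 0" by (simp add: S_def)
    obtain m n where m: "m \<ge> 1" "(act A ^^ m) (point y) x > 0"
      and n: "(act A ^^ n) (point x) y > 0"
      using assms unfolding irreducible_act_def by meson
    have "m + n \<in> S x" "m + k + n \<in> S x"
      using m act_pow_point_trans[OF m(2) n]
        act_pow_point_trans[OF act_pow_point_trans[OF m(2) k] n] by (auto simp: S_def)
    then have "Gcd (S x) dvd m + n" "Gcd (S x) dvd (m + n) + k"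
      by (auto simp: add_ac intro: Gcd_dvd)
    then show "Gcd (S x) dvd k" by (simp only: dvd_add_right_iff)
  qed
  then show ?thesis unfolding S_def[symmetric] by (blast intro: dvd_antisym)
qed

section \<open>Real-valued power entries and their averaged limits\<close>

lemma enn2real_sums:
  assumes "\<And>i. f i < \<infinity>" and "(\<Sum>i. f i) < \<infinity>"
  shows "(\<lambda>i. enn2real (f i)) sums enn2real (\<Sum>i. f i)"
proof -
  have "(\<lambda>i. ennreal (enn2real (f i))) sums ennreal (enn2real (\<Sum>i. f i))"
    using assms summable_sums[OF summableI, of f] by simp
  then show ?thesis by (subst (asm) sums_ennreal) auto
qed

definition pow_real :: "('s \<Rightarrow> 's \<Rightarrow> ennreal) \<Rightarrow> 's \<Rightarrow> 's \<Rightarrow> nat \<Rightarrow> real" where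
  "pow_real A x y n = enn2real ((act A ^^ n) (point y) x)"

context
  fixes A :: "'s::countable \<Rightarrow> 's \<Rightarrow> ennreal" and z :: 's
  assumes irr: "irreducible_act A"
    and one: "hit_total A z z = 1"
    and mean_fin: "(\<Sum>k. of_nat (Suc k) * first_hit A z k z) < \<infinity>"
    and pow_fin: "\<And>n x y. (act A ^^ n) (point y) x < \<infinity>"
begin

lemma first_hit_finite: "first_hit A z i x < \<infinity>"
proof -
  have "first_hit A z i x \<le> hit_total A z x"
    unfolding hit_total_def using sum_le_suminf[of "\<lambda>i. first_hit A z i x" "{i}"]
    by (simp add: summableI)
  then show ?thesis using hit_total_finite[OF irr one, of x] by (rule le_less_trans)
qed

lemma first_hit_sums:
  "(\<lambda>i. enn2real (first_hit A z i x)) sums enn2real (hit_total A z x)"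
  using hit_total_finite[OF irr one, of x] first_hit_finite unfolding hit_total_def
  by (intro enn2real_sums)

lemma taboo_pow_finite: "(taboo_act A z ^^ n) (point y) x < \<infinity>"
proof -
  have "(taboo_act A z ^^ n) (point y) x \<le> (\<Sum>n. (taboo_act A z ^^ n) (point y) x)"
    using sum_le_suminf[of "\<lambda>n. (taboo_act A z ^^ n) (point y) x" "{n}"] by (simp add: summableI)
  then show ?thesis using taboo_pow_point_summable[OF irr one, of y x] by (rule le_less_trans)
qed

lemma taboo_pow_tendsto_0: "(\<lambda>n. enn2real ((taboo_act A z ^^ n) (point y) x)) \<longlonglongrightarrow> 0"
  using enn2real_sums[OF taboo_pow_finite taboo_pow_point_summable[OF irr one]]
  by (intro summable_LIMSEQ_zero) (rule sums_summable)

lemma pow_real_first_entrance: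
  "pow_real A x y (Suc n) = enn2real ((taboo_act A z ^^ Suc n) (point y) x)
     + (\<Sum>i\<le>n. enn2real (first_hit A z i x) * pow_real A z y (n - i))"
proof -
  have "ennreal (pow_real A x y (Suc n)) = (act A ^^ Suc n) (point y) x"
    using pow_fin[of "Suc n" y x] by (simp only: pow_real_def ennreal_enn2real infinity_ennreal_def)
  also have "\<dots> = (taboo_act A z ^^ Suc n) (point y) x
      + (\<Sum>i\<le>n. first_hit A z i x * (act A ^^ (n - i)) (point y) z)"
    unfolding first_entrance[where z = z and n = "Suc n"] by (simp add: lessThan_Suc_atMost)
  also have "\<dots> = ennreal (enn2real ((taboo_act A z ^^ Suc n) (point y) x))
      + (\<Sum>i\<le>n. ennreal (enn2real (first_hit A z i x) * pow_real A z y (n - i)))"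
    using taboo_pow_finite[of "Suc n" y x] first_hit_finite pow_fin
    by (simp only: pow_real_def ennreal_mult'' enn2real_nonneg ennreal_enn2real infinity_ennreal_def)
  also have "\<dots> = ennreal (enn2real ((taboo_act A z ^^ Suc n) (point y) x)
     + (\<Sum>i\<le>n. enn2real (first_hit A z i x) * pow_real A z y (n - i)))"
    by (simp add: pow_real_def sum_nonneg del: funpow.simps)
  finally show ?thesis
    by (subst (asm) ennreal_inj) (auto simp: pow_real_def intro!: add_nonneg_nonneg sum_nonneg)
qed

text \<open>On the diagonal at \<open>z\<close> the taboo remainder vanishes, so the first-entrance
  decomposition is a renewal equation.\<close>

lemma pow_real_renewal:
  defines "p \<equiv> Gcd {k. 1 \<le> k \<and> (act A ^^ k) (point z) z > 0}"
  shows "renewal (\<lambda>i. enn2real (first_hit A z i z)) (pow_real A z z)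
      (enn2real (\<Sum>k. of_nat (Suc k) * first_hit A z k z)) p"
proof
  fix i n
  show "0 \<le> enn2real (first_hit A z i z)" by simp
  show "(\<lambda>i. enn2real (first_hit A z i z)) sums 1" using first_hit_sums[of z] one by simp
  have "of_nat (Suc k) * first_hit A z k z < \<infinity>" for k
    using first_hit_finite[of k z] by (simp add: ennreal_mult_less_top ennreal_of_nat_eq_real_of_nat del: of_nat_Suc)
  from enn2real_sums[OF this mean_fin]
  show "(\<lambda>i. real (Suc i) * enn2real (first_hit A z i z)) sums
      enn2real (\<Sum>k. of_nat (Suc k) * first_hit A z k z)"
    by (simp only: enn2real_mult enn2real_of_nat)
  show "pow_real A z z 0 = 1" by (simp add: pow_real_def point_def)
  show "pow_real A z z (Suc n) = (\<Sum>i\<le>n. enn2real (first_hit A z i z) * pow_real A z z (n - i))"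
    by (simp only: pow_real_first_entrance taboo_pow_point_self) simp
  show "Gcd {k. 1 \<le> k \<and> 0 < pow_real A z z k} = p"
    using pow_fin by (simp add: p_def pow_real_def enn2real_positive_iff)
  obtain k where "1 \<le> k" "(act A ^^ k) (point z) z > 0"
    using irr unfolding irreducible_act_def by blast
  then have "p \<noteq> 0" unfolding p_def by (auto simp: Gcd_0_iff)
  then show "p > 0" by simp
qed

end

lemma window_avg_pow_real_tendsto:
  fixes A :: "'s::countable \<Rightarrow> 's \<Rightarrow> ennreal"
  defines "A' \<equiv> \<lambda>x y. A y x"
  assumes irr: "irreducible_act A"
    and one: "hit_total A z z = 1"
    and mean_fin: "(\<Sum>k. of_nat (Suc k) * first_hit A z k z) < \<infinity>"
    and pow_fin: "\<And>n x y. (act A ^^ n) (point y) x < \<infinity>"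
    and p: "p = Gcd {k. 1 \<le> k \<and> (act A ^^ k) (point z) z > 0}"
  shows "window_avg p (pow_real A x y) \<longlonglongrightarrow>
    enn2real (hit_total A z x) * (enn2real (hit_total A' z y)
      * (1 / enn2real (\<Sum>k. of_nat (Suc k) * first_hit A z k z)))"
proof -
  interpret renewal "\<lambda>i. enn2real (first_hit A z i z)" "pow_real A z z"
    "enn2real (\<Sum>k. of_nat (Suc k) * first_hit A z k z)" p
    unfolding p by (rule pow_real_renewal[OF irr one mean_fin pow_fin])
  have irr': "irreducible_act A'" unfolding A'_def by (rule irreducible_transpose[OF irr])
  have one': "hit_total A' z z = 1"
    using one unfolding A'_def hit_total_def by (simp only: first_hit_transpose_self[where A = A])
  have mean_fin': "(\<Sum>k. of_nat (Suc k) * first_hit A' z k z) < \<infinity>"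
    using mean_fin unfolding A'_def by (simp only: first_hit_transpose_self[where A = A])
  have pow_fin': "(act A' ^^ n) (point y) x < \<infinity>" for n x y
    using pow_fin unfolding A'_def by (simp only: act_pow_point_transpose[where A = A])
  have pow_real': "pow_real A' x y n = pow_real A y x n" for x y n
    unfolding pow_real_def A'_def by (simp only: act_pow_point_transpose[where A = A])
  \<comment> \<open>The first-entrance identity of the transposed matrix from \<open>y\<close> to
    \<open>z\<close>, again without remainder.\<close>
  have last_exit: "pow_real A z y (Suc n)
      = (\<Sum>i\<le>n. enn2real (first_hit A' z i y) * pow_real A z z (n - i))" for n
    using pow_real_first_entrance[OF irr' one' mean_fin' pow_fin', of y z n]
    by (simp only: pow_real' taboo_pow_point_self) simp
  have z_bound: "\<bar>pow_real A z z n\<bar> \<le> 1" for n using a_bounds[of n] by simp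
  have zy: "window_avg p (pow_real A z y) \<longlonglongrightarrow> enn2real (hit_total A' z y)
      * (1 / enn2real (\<Sum>k. of_nat (Suc k) * first_hit A z k z))"
    using enn2real_nonneg first_hit_sums[OF irr' one' mean_fin' pow_fin', of y] z_bound renewal_theorem
      tendsto_const p_pos
    by (rule window_avg_renewal_tendsto) (simp add: last_exit)
  \<comment> \<open>The uniform bound needed for dominated convergence in the second convolution;
    the summand 1 covers \<open>n = 0\<close>.\<close>
  have "\<bar>pow_real A z y n\<bar> \<le> 1 + enn2real (hit_total A' z y)" for n
  proof (cases n)
    case 0
    then show ?thesis by (simp add: pow_real_def point_def)
  next
    case (Suc k)
    have "pow_real A z y (Suc k) \<le> (\<Sum>i\<le>k. enn2real (first_hit A' z i y))"
      unfolding last_exit using a_bounds by (intro sum_mono) (auto intro!: mult_left_le)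
    also have "\<dots> \<le> enn2real (hit_total A' z y)"
      using first_hit_sums[OF irr' one' mean_fin' pow_fin', of y]
        sum_le_suminf[of "\<lambda>i. enn2real (first_hit A' z i y)" "{..k}"] by (auto simp: sums_iff)
    finally show ?thesis using Suc by (simp add: pow_real_def)
  qed
  with enn2real_nonneg first_hit_sums[OF irr one mean_fin pow_fin, of x]
  show ?thesis
    using zy taboo_pow_tendsto_0[OF irr one mean_fin pow_fin] p_pos
      pow_real_first_entrance[OF irr one mean_fin pow_fin]
    by (rule window_avg_renewal_tendsto)
qed

section \<open>Eigenvectors, summable pairing and ratio limit for the killed chain\<close>

theorem theorem2:
  fixes B :: "'s::countable \<Rightarrow> 's \<Rightarrow> real"
    and z :: 's
    and Q :: "'s option \<Rightarrow> 'w measure"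
    and X :: "nat \<Rightarrow> 'w \<Rightarrow> 's option"
    and \<theta> lam :: real
    and us es :: "'s \<Rightarrow> real"
  assumes sub: "substochastic B"
    and irr: "irreducible_mat B"
    and chain: "\<And>x. markov_chain (Q x) X (cemetery_ext B) x"
    and theta: "\<theta> \<ge> 0"
    and one: "(\<integral>\<^sup>+\<omega>. exp_return \<theta> X z \<omega> \<partial>Q (Some z)) = 1"
    and fin: "(\<integral>\<^sup>+\<omega>. time_exp_return \<theta> X z \<omega> \<partial>Q (Some z)) < \<infinity>"
    and lam: "lam = exp (- \<theta>)"
    and us: "\<And>x. us x = enn2real (u_star Q X \<theta> z x)"
    and es: "\<And>y. es y = enn2real (eta_star Q X \<theta> z y)"
  shows "((\<forall>x. u_star Q X \<theta> z x < \<infinity>) \<and> (\<forall>y. eta_star Q X \<theta> z y < \<infinity>))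
    \<and> (\<forall>u. (\<forall>x. u x > 0) \<and> right_eigenvector B lam u \<longrightarrow> (\<exists>c>0. \<forall>x. u x = c * us x))
    \<and> (\<forall>\<eta>. (\<forall>y. \<eta> y > 0) \<and> left_eigenvector B lam \<eta> \<longrightarrow> (\<exists>c>0. \<forall>y. \<eta> y = c * es y))
    \<and> (\<lambda>w. es w * us w) summable_on UNIV
    \<and> (\<forall>v p. p = period_at B v \<longrightarrow>
         (\<forall>x y. (\<lambda>n. (1 / real p) *
                    (\<Sum>j<p. lam powi (- int (p * n) - int j) * mat_pow B (p * n + j) x y))
            \<longlonglongrightarrow> us x * es y / (\<Sum>\<^sub>\<infinity>w. us w * es w)))"
proof -
  define A where "A x y = ennreal (exp \<theta> * B x y)" for x y
  define A' where "A' x y = A y x" for x y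
  have A_eq: "A = (\<lambda>x y. ennreal (exp \<theta> * B x y))" by (simp add: A_def fun_eq_iff)
  have A'_eq: "A' = (\<lambda>x y. A y x)" by (simp add: A'_def fun_eq_iff)
  have B_nonneg: "B x y \<ge> 0" for x y using sub by (simp add: substochastic_def)
  have pow: "(act A ^^ n) (point y) x = ennreal (exp (\<theta> * real n) * mat_pow B n x y)" for n x y
    unfolding A_eq by (rule act_pow_mat_pow[OF sub])
  have pow_pos: "(act A ^^ n) (point y) x > 0 \<longleftrightarrow> mat_pow B n x y > 0" for n x y
    unfolding pow by (simp add: zero_less_mult_iff)
  have irrA: "irreducible_act A"
    using irr unfolding irreducible_act_def irreducible_mat_def pow_pos .
  have irrA': "irreducible_act A'" unfolding A'_eq by (rule irreducible_transpose[OF irrA])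
  have u_hit: "u_star Q X \<theta> z x = hit_total A z x" for x
    unfolding u_star_def A_eq by (rule nn_integral_exp_return[OF chain])
  have hit1: "hit_total A z z = 1"
    using one u_hit[of z] by (simp add: u_star_def)
  have eta_hit: "eta_star Q X \<theta> z y = hit_total A' z y" for y
  proof -
    have "eta_star Q X \<theta> z y = (\<Sum>j. (taboo_act A z ^^ j) (point y) z)"
      unfolding eta_star_def A_eq by (rule nn_integral_visits[OF chain])
    then show ?thesis unfolding A'_eq by (simp only: taboo_total_eq[OF hit1])
  qed
  have mean_fin: "(\<Sum>k. of_nat (Suc k) * first_hit A z k z) < \<infinity>"
    using fin unfolding A_eq nn_integral_time_exp_return[OF chain] .
  have pow_fin: "(act A ^^ n) (point y) x < \<infinity>" for n x y by (simp add: pow)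
  have hit1': "hit_total A' z z = 1"
    using hit1 unfolding A'_eq hit_total_def by (simp only: first_hit_transpose_self[where A = A])
  have u_fin: "hit_total A z x < \<infinity>" for x by (rule hit_total_finite[OF irrA hit1])
  have eta_fin: "hit_total A' z y < \<infinity>" for y by (rule hit_total_finite[OF irrA' hit1'])
  have ennreal_us: "ennreal (us x) = hit_total A z x" for x
    using u_fin[of x] by (simp add: us u_hit)
  have ennreal_es: "ennreal (es y) = hit_total A' z y" for y
    using eta_fin[of y] by (simp add: es eta_hit)
  have us_nonneg: "us x \<ge> 0" and es_nonneg: "es x \<ge> 0" for x by (simp_all add: us es)
  \<comment> \<open>Since \<open>exp \<theta> * lam = 1\<close>, eigenvectors of \<open>B\<close>
    for \<open>lam\<close> are exactly vectors fixed by \<open>A\<close>.\<close>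
  have scale: "exp \<theta> * (lam * c) = c" for c by (simp add: lam exp_minus)
  have right: "\<exists>c>0. \<forall>x. u x = c * us x" if pos: "\<forall>x. u x > 0" and eig: "right_eigenvector B lam u" for u
  proof -
    have fixed: "act A (\<lambda>x. ennreal (u x)) = (\<lambda>x. ennreal (u x))"
    proof
      fix x
      have "((\<lambda>y. B x y * u y) has_sum lam * u x) UNIV"
        using eig by (simp add: right_eigenvector_def)
      then have "act A (\<lambda>x. ennreal (u x)) x = ennreal (exp \<theta> * (lam * u x))"
        unfolding A_eq by (intro act_scaled_has_sum B_nonneg less_imp_le[OF pos[rule_format]])
      then show "act A (\<lambda>x. ennreal (u x)) x = ennreal (u x)" by (simp only: scale)
    qed
    \<comment> \<open>The multiple is \<open>u z\<close>, as \<open>us\<close> has value 1 at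
      \<open>z\<close>.\<close>
    have "ennreal (u x) = ennreal (u z * us x)" for x
      unfolding ennreal_mult''[OF us_nonneg] ennreal_us
      by (rule eigenvector_unique[OF irrA hit1 fixed]) simp
    then have "u x = u z * us x" for x
      by (rule ennreal_inj[THEN iffD1, rotated 2]) (use pos us_nonneg in \<open>simp_all add: less_imp_le\<close>)
    then show ?thesis using pos by blast
  qed
  have left: "\<exists>c>0. \<forall>y. \<eta> y = c * es y" if pos: "\<forall>y. \<eta> y > 0" and eig: "left_eigenvector B lam \<eta>" for \<eta>
  proof -
    have fixed: "act A' (\<lambda>x. ennreal (\<eta> x)) = (\<lambda>x. ennreal (\<eta> x))"
    proof
      fix y
      have "((\<lambda>x. B x y * \<eta> x) has_sum lam * \<eta> y) UNIV"
        using eig by (simp add: left_eigenvector_def mult.commute)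
      then have "act A' (\<lambda>x. ennreal (\<eta> x)) y = ennreal (exp \<theta> * (lam * \<eta> y))"
        unfolding A'_eq A_eq
        by (intro act_scaled_has_sum[where B = "\<lambda>x y. B y x"] B_nonneg less_imp_le[OF pos[rule_format]])
      then show "act A' (\<lambda>x. ennreal (\<eta> x)) y = ennreal (\<eta> y)" by (simp only: scale)
    qed
    have "ennreal (\<eta> y) = ennreal (\<eta> z * es y)" for y
      unfolding ennreal_mult''[OF es_nonneg] ennreal_es
      by (rule eigenvector_unique[OF irrA' hit1' fixed]) simp
    then have "\<eta> y = \<eta> z * es y" for y
      by (rule ennreal_inj[THEN iffD1, rotated 2]) (use pos es_nonneg in \<open>simp_all add: less_imp_le\<close>)
    then show ?thesis using pos by blast
  qed
  have pairing: "(\<integral>\<^sup>+ w. ennreal (es w * us w) \<partial>count_space UNIV)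
      = (\<Sum>k. of_nat (Suc k) * first_hit A z k z)"
    using pairing_eq[OF hit1] us_nonneg es_nonneg
    by (simp add: ennreal_mult ennreal_us ennreal_es A'_eq del: of_nat_Suc)
  have summ: "(\<lambda>w. es w * us w) summable_on UNIV"
    using pairing mean_fin us_nonneg es_nonneg by (intro summable_on_if_nn_integral_finite) simp_all
  define m where "m = enn2real (\<Sum>k. of_nat (Suc k) * first_hit A z k z)"
  have m: "(\<Sum>\<^sub>\<infinity>w. us w * es w) = m"
  proof -
    have "ennreal (\<Sum>\<^sub>\<infinity>w. es w * us w) = (\<Sum>k. of_nat (Suc k) * first_hit A z k z)"
      using nn_integral_count_space_has_sum[OF _ has_sum_infsum[OF summ]] us_nonneg es_nonneg pairing
      by simp
    then have "m = (\<Sum>\<^sub>\<infinity>w. es w * us w)"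
      unfolding m_def using us_nonneg es_nonneg
      by (metis (no_types, lifting) enn2real_ennreal infsum_nonneg mult_nonneg_nonneg)
    then show ?thesis by (simp add: mult.commute)
  qed
  have limit: "(\<lambda>n. (1 / real p) *
          (\<Sum>j<p. lam powi (- int (p * n) - int j) * mat_pow B (p * n + j) x y))
        \<longlonglongrightarrow> us x * es y / (\<Sum>\<^sub>\<infinity>w. us w * es w)"
    if p: "p = period_at B v" for p v x y
  proof -
    \<comment> \<open>The period may be taken at \<open>z\<close>, where the renewal sequence
      lives.\<close>
    have p_eq: "p = Gcd {k. 1 \<le> k \<and> (act A ^^ k) (point z) z > 0}"
      using period_independent[OF irrA, of v z] unfolding p period_at_def pow_pos .
    interpret renewal "\<lambda>i. enn2real (first_hit A z i z)" "pow_real A z z" m p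
      unfolding p_eq m_def by (rule pow_real_renewal[OF irrA hit1 mean_fin pow_fin])
    have scaled_pow: "lam powi (- int (p * n) - int j) * mat_pow B (p * n + j) x y
        = pow_real A x y (p * n + j)" for n j
    proof -
      have "- int (p * n) - int j = - int (p * n + j)" by simp
      then have "lam powi (- int (p * n) - int j) = inverse (exp (- \<theta>) ^ (p * n + j))"
        by (simp only: lam power_int_minus power_int_of_nat)
      also have "\<dots> = exp (\<theta> * real (p * n + j))"
        by (simp add: exp_minus power_inverse flip: exp_of_nat2_mult)
      finally show ?thesis
        using mat_pow_bounds[OF sub, of "p * n + j" x y] by (simp add: pow_real_def pow)
    qed
    \<comment> \<open>The indices from \<open>p * n\<close> to \<open>p * n + p - 1\<close> form the
      window ending at \<open>p * n + (p - 1)\<close>, which \<open>window_avg\<close> lists in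
      reverse order.\<close>
    have "(1 / real p) * (\<Sum>j<p. lam powi (- int (p * n) - int j) * mat_pow B (p * n + j) x y)
        = window_avg p (pow_real A x y) (p * n + (p - 1))" for n
    proof -
      have "(\<Sum>j<p. pow_real A x y (p * n + j))
          = (\<Sum>i<p. pow_real A x y (p * n + (p - Suc i)))"
        by (rule sum.nat_diff_reindex[symmetric])
      also have "\<dots> = (\<Sum>i<p. if i \<le> p * n + (p - 1)
          then pow_real A x y (p * n + (p - 1) - i) else 0)"
        by (intro sum.cong) auto
      finally show ?thesis unfolding scaled_pow window_avg_def by (simp only: times_divide_eq_left mult_1)
    qed
    moreover have "filterlim (\<lambda>n. p * n + (p - 1)) at_top sequentially"
    proof (rule filterlim_at_top_mono[OF filterlim_ident])
      show "\<forall>\<^sub>F n in sequentially. n \<le> p * n + (p - 1)"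
        using p_pos by (intro always_eventually allI trans_le_add1) simp
    qed
    note filterlim_compose[OF window_avg_pow_real_tendsto[OF irrA hit1 mean_fin pow_fin p_eq] this, of x y]
    moreover have "enn2real (hit_total A z x) * (enn2real (hit_total (\<lambda>x y. A y x) z y)
        * (1 / enn2real (\<Sum>k. of_nat (Suc k) * first_hit A z k z)))
        = us x * es y / (\<Sum>\<^sub>\<infinity>w. us w * es w)"
      unfolding m unfolding m_def us es u_hit eta_hit A'_eq by simp
    ultimately show ?thesis by (simp only:)
  qed
  show ?thesis
    using u_fin eta_fin right left summ limit by (simp add: u_hit eta_hit)
qed

end
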